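(* Let $A\in\mathbb{R}^{2\times 2}$ have real eigenvalues, let $\zeta\in\mathbb{R}^2$ be nonzero, let $\Omega=[u^-,u^+]$ with $u^-<u^+$, and consider the linear control system $\Sigma_{\mathbb{R}^2}$: $\dot v(t)=Av(t)+u(t)\zeta$, $u(t)\in\Omega$. Assume that $\Sigma_{\mathbb{R}^2}$ satisfies the LARC and that $\det A>0$. Then $\Sigma_{\mathbb{R}^2}$ admits a unique control set $\mathcal{C}_{\mathbb{R}^2}$ with nonempty interior, and it satisfies $$\operatorname{int}\mathcal{C}_{\mathbb{R}^2}=\operatorname{Im}(f),$$ where $f$ is the map $$f:(0,+\infty)^2\to\mathbb{R}^2,\qquad f(s,t)=\varphi\big(\epsilon s,\varphi(\epsilon t,v(u^-),u^+),u^-\big),\qquad \epsilon=\begin{cases}1&\text{if }\operatorname{tr}A<0,\\-1&\text{if }\operatorname{tr}A>0,\end{cases}$$ which is a diffeomorphism onto its image. Moreover, $\mathcal{C}_{\mathbb{R}^2}$ is closed if $\operatorname{tr}A<0$ and open if $\operatorname{tr}A>0$.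
   Context: The set $\mathcal{U}$ of control functions consists of all piecewise constant functions $\mathbf{u}:\mathbb{R}\to\mathbb{R}$ with image in $\Omega$. For $v\in\mathbb{R}^2$ and $\mathbf{u}\in\mathcal{U}$, $s\mapsto\varphi(s,v,\mathbf{u})$, $s\in\mathbb{R}$, is the unique continuous, piecewise differentiable solution of $\frac{d}{ds}\varphi(s,v,\mathbf{u})=A\varphi(s,v,\mathbf{u})+\mathbf{u}(s)\zeta$ with $\varphi(0,v,\mathbf{u})=v$. For a constant control $u\in\Omega$ (and $\det A\ne 0$) one has $\varphi(t,v,u)=e^{tA}(v-v(u))+v(u)$ for all $t\in\mathbb{R}$, where $v(u):=-uA^{-1}\zeta$. The positive orbit of $v$ is $\mathcal{O}^+(v)=\{\varphi(t,v,\mathbf{u}): t\ge 0,\ \mathbf{u}\in\mathcal{U}\}$. LARC: $\langle A\zeta,\theta\zeta\rangle\neq 0$, where $\theta$ is the counter-clockwise rotation by $\pi/2$; equivalently, $\zeta$ is not an eigenvector of $A$. A nonempty set $\mathcal{C}\subset\mathbb{R}^2$ is a control set of $\Sigma_{\mathbb{R}^2}$ if: (1) for every $v\in\mathcal{C}$ there is $\mathbf{u}\in\mathcal{U}$ with $\varphi(t,v,\mathbf{u})\in\mathcal{C}$ for all $t\geq 0$; (2) for every $v\in\mathcal{C}$, $\mathcal{C}\subset\overline{\mathcal{O}^+(v)}$; (3) $\mathcal{C}$ is maximal with respect to set inclusion among sets satisfying (1) and (2). *)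

theory Defs
  imports "HOL-Analysis.Analysis"
begin

section \<open>Linear control systems on the plane\<close>

definition has_real_eigenvalues :: "real^2^2 \<Rightarrow> bool" where
  "has_real_eigenvalues A \<longleftrightarrow>
     (\<forall>(lam::complex) (w::complex^2). w \<noteq> 0 \<and> (\<chi> i j. complex_of_real (A $ i $ j)) *v w = lam *s w
        \<longrightarrow> lam \<in> \<real>)"

definition rot90 :: "real^2^2" where
  "rot90 = vector [vector [0, -1], vector [1, 0]]"

definition LARC :: "real^2^2 \<Rightarrow> real^2 \<Rightarrow> bool" where
  "LARC A \<zeta> \<longleftrightarrow> (A *v \<zeta>) \<bullet> (rot90 *v \<zeta>) \<noteq> 0"

definition locally_finite_points :: "real set \<Rightarrow> bool" where
  "locally_finite_points S \<longleftrightarrow> (\<forall>a b. finite (S \<inter> {a..b}))"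

text \<open>Finitely many pieces on every bounded interval; the values at the breakpoints are arbitrary.\<close>

definition piecewise_constant :: "(real \<Rightarrow> real) \<Rightarrow> bool" where
  "piecewise_constant u \<longleftrightarrow>
     (\<exists>S. locally_finite_points S \<and> (\<forall>a b. {a..b} \<inter> S = {} \<longrightarrow> u constant_on {a..b}))"

definition controls :: "real set \<Rightarrow> (real \<Rightarrow> real) set" where
  "controls \<Omega> = {u. piecewise_constant u \<and> range u \<subseteq> \<Omega>}"

text \<open>A solution is a continuous curve that is differentiable and satisfies the equation off a
  locally finite set of times (at a breakpoint of the control it need not be differentiable).\<close>

definition is_solution ::
  "real^2^2 \<Rightarrow> real^2 \<Rightarrow> real^2 \<Rightarrow> (real \<Rightarrow> real) \<Rightarrow> (real \<Rightarrow> real^2) \<Rightarrow> bool" where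
  "is_solution A \<zeta> v u x \<longleftrightarrow>
     continuous_on UNIV x \<and> x 0 = v \<and>
     (\<exists>S. locally_finite_points S \<and>
        (\<forall>s. s \<notin> S \<longrightarrow> (x has_vector_derivative (A *v x s + u s *\<^sub>R \<zeta>)) (at s)))"

text \<open>For a piecewise constant control the solution exists and is unique, so \<open>THE\<close> picks it.\<close>

definition phi :: "real^2^2 \<Rightarrow> real^2 \<Rightarrow> real \<Rightarrow> real^2 \<Rightarrow> (real \<Rightarrow> real) \<Rightarrow> real^2" where
  "phi A \<zeta> s v u = (THE x. is_solution A \<zeta> v u x) s"

definition positive_orbit :: "real^2^2 \<Rightarrow> real^2 \<Rightarrow> real set \<Rightarrow> real^2 \<Rightarrow> (real^2) set" where
  "positive_orbit A \<zeta> \<Omega> v = {phi A \<zeta> t v u | t u. 0 \<le> t \<and> u \<in> controls \<Omega>}"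

definition controlled_invariant :: "real^2^2 \<Rightarrow> real^2 \<Rightarrow> real set \<Rightarrow> (real^2) set \<Rightarrow> bool" where
  "controlled_invariant A \<zeta> \<Omega> C \<longleftrightarrow>
     (\<forall>v\<in>C. \<exists>u\<in>controls \<Omega>. \<forall>t\<ge>0. phi A \<zeta> t v u \<in> C)"

definition approx_controllable :: "real^2^2 \<Rightarrow> real^2 \<Rightarrow> real set \<Rightarrow> (real^2) set \<Rightarrow> bool" where
  "approx_controllable A \<zeta> \<Omega> C \<longleftrightarrow> (\<forall>v\<in>C. C \<subseteq> closure (positive_orbit A \<zeta> \<Omega> v))"

definition control_set :: "real^2^2 \<Rightarrow> real^2 \<Rightarrow> real set \<Rightarrow> (real^2) set \<Rightarrow> bool" where
  "control_set A \<zeta> \<Omega> C \<longleftrightarrow>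
     C \<noteq> {} \<and> controlled_invariant A \<zeta> \<Omega> C \<and> approx_controllable A \<zeta> \<Omega> C \<and>
     (\<forall>D. C \<subseteq> D \<and> controlled_invariant A \<zeta> \<Omega> D \<and> approx_controllable A \<zeta> \<Omega> D \<longrightarrow> D = C)"

definition equilibrium :: "real^2^2 \<Rightarrow> real^2 \<Rightarrow> real \<Rightarrow> real^2" where
  "equilibrium A \<zeta> u = - (u *\<^sub>R (matrix_inv A *v \<zeta>))"

text \<open>The case \<open>trace A = 0\<close> is irrelevant: it cannot occur for real eigenvalues and \<open>det A > 0\<close>.\<close>

definition trace_sign :: "real^2^2 \<Rightarrow> real" where
  "trace_sign A = (if trace A < 0 then 1 else -1)"

definition switch_map :: "real^2^2 \<Rightarrow> real^2 \<Rightarrow> real \<Rightarrow> real \<Rightarrow> real \<times> real \<Rightarrow> real^2" where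
  "switch_map A \<zeta> um up = (\<lambda>(s, t).
     phi A \<zeta> (trace_sign A * s)
       (phi A \<zeta> (trace_sign A * t) (equilibrium A \<zeta> um) (\<lambda>_. up)) (\<lambda>_. um))"


section \<open>Diffeomorphisms onto the image\<close>

text \<open>On an open set, \<open>Ck_on n\<close> is the class of \<open>n\<close> times continuously differentiable functions,
  expressed through iterated directional derivatives.\<close>

primrec Ck_on :: "nat \<Rightarrow> 'a::euclidean_space set \<Rightarrow> ('a \<Rightarrow> 'b::euclidean_space) \<Rightarrow> bool" where
  "Ck_on 0 S f \<longleftrightarrow> continuous_on S f"
| "Ck_on (Suc n) S f \<longleftrightarrow>
     (\<forall>x\<in>S. f differentiable (at x)) \<and> (\<forall>h. Ck_on n S (\<lambda>x. frechet_derivative f (at x) h))"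

definition smooth_on :: "'a::euclidean_space set \<Rightarrow> ('a \<Rightarrow> 'b::euclidean_space) \<Rightarrow> bool" where
  "smooth_on S f \<longleftrightarrow> (\<forall>n. Ck_on n S f)"

definition diffeomorphism_onto_image ::
  "('a::euclidean_space \<Rightarrow> 'b::euclidean_space) \<Rightarrow> 'a set \<Rightarrow> bool" where
  "diffeomorphism_onto_image f S \<longleftrightarrow>
     open S \<and> open (f ` S) \<and> inj_on f S \<and> smooth_on S f \<and> smooth_on (f ` S) (inv_into S f)"

end

theory Submission
  imports Defs "HOL-Real_Asymp.Real_Asymp"
begin

text \<open>
  Write \<open>B = \<epsilon> A\<close>, so that \<open>B\<close> has eigenvalues \<open>\<mu>2 \<le> \<mu>1 < 0\<close>, let \<open>v\<^sup>-\<close>, \<open>v\<^sup>+\<close> be the equilibria of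
  the extreme controls and \<open>w = v\<^sup>+ - v\<^sup>-\<close>. Then
  \<open>f(s,t) = v\<^sup>- + e\<^bsup>sB\<^esup> w - e\<^bsup>(s+t)B\<^esup> w\<close>. In the basis \<open>w, (B - \<mu>1)w\<close> the curve
  \<open>e\<^bsup>sB\<^esup> w\<close> is the graph of a strictly concave function \<open>h\<close> of \<open>x = e\<^bsup>\<mu>1 s\<^esup>\<close> with
  \<open>h(0) = h(1) = 0\<close>, so \<open>f\<close> becomes \<open>(x, y) \<mapsto> (x - y, h(x) - h(y))\<close>, whose image is the open lens
  \<open>-h(1 - c) < d < h(c)\<close>. Hence \<open>G = Im f\<close> is convex and centrally symmetric. It is
  invariant under the control \<open>u\<^sup>-\<close> (which shifts \<open>s\<close>), by symmetry under \<open>u\<^sup>+\<close>, and by convexity under all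
  controls, in the stable direction of time. A Brouwer fixed point argument shows that every point of
  \<open>G\<close> is reached exactly, in that direction of time, from every point of the plane.
  Since two trajectories with the same control synchronize, recurrent points lie in \<open>closure G\<close>. For
  \<open>tr A < 0\<close> this makes \<open>closure G\<close> the control set. For \<open>tr A > 0\<close>, where \<open>G\<close> is backward
  invariant, a trajectory that ever enters \<open>G\<close> has started there, and the control set is \<open>G\<close>.
\<close>

section \<open>Functions of class \<open>C\<^sup>k\<close>\<close>

lemma Ck_on_cong:
  assumes "open S" "\<And>x. x \<in> S \<Longrightarrow> f x = g x" "Ck_on n S f"
  shows "Ck_on n S g"
  using assms
proof (induction n arbitrary: f g)
  case 0
  then show ?case by (metis Ck_on.simps(1) continuous_on_cong)
next
  case (Suc n)
  have deriv: "(g has_derivative frechet_derivative f (at x)) (at x)" if "x \<in> S" for x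
  proof -
    have "(f has_derivative frechet_derivative f (at x)) (at x)"
      using Suc.prems(3) that frechet_derivative_works by auto
    then show ?thesis
      by (rule has_derivative_transform_within_open[OF _ \<open>open S\<close> that]) (use Suc.prems in auto)
  qed
  have "Ck_on n S (\<lambda>x. frechet_derivative g (at x) h)" for h
  proof (rule Suc.IH[OF Suc.prems(1)])
    show "frechet_derivative f (at x) h = frechet_derivative g (at x) h" if "x \<in> S" for x
      using frechet_derivative_at[OF deriv[OF that]] by (rule fun_cong)
    show "Ck_on n S (\<lambda>x. frechet_derivative f (at x) h)"
      using Suc.prems(3) unfolding Ck_on.simps by blast
  qed
  moreover have "\<forall>x\<in>S. g differentiable (at x)" using deriv unfolding differentiable_def by blast
  ultimately show ?case by simp
qed

text \<open>\<open>frechet_derivative\<close> is defined by choice; this rule lets any explicit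
  derivative on the open set stand in for it.\<close>

lemma Ck_on_Suc_intro:
  assumes "open S" and deriv: "\<And>x. x \<in> S \<Longrightarrow> (f has_derivative f' x) (at x)"
    and "\<And>h. Ck_on n S (\<lambda>x. f' x h)"
  shows "Ck_on (Suc n) S f"
proof -
  have "frechet_derivative f (at x) = f' x" if "x \<in> S" for x
    by (rule frechet_derivative_at[OF deriv[OF that], symmetric])
  then have "Ck_on n S (\<lambda>x. frechet_derivative f (at x) h)" for h
    by (intro Ck_on_cong[OF assms(1) _ assms(3)[of h]]) simp
  moreover have "\<forall>x\<in>S. f differentiable (at x)" using deriv unfolding differentiable_def by blast
  ultimately show ?thesis by simp
qed

lemma Ck_on_Suc_elim:
  assumes "Ck_on (Suc n) S f" "open S"
  obtains f' where "\<And>x. x \<in> S \<Longrightarrow> (f has_derivative f' x) (at x)" "\<And>h. Ck_on n S (\<lambda>x. f' x h)"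
proof
  show "(f has_derivative frechet_derivative f (at x)) (at x)" if "x \<in> S" for x
    using assms that frechet_derivative_works by auto
  show "Ck_on n S (\<lambda>x. frechet_derivative f (at x) h)" for h
    using assms by simp
qed

lemma Ck_on_imp_continuous: 
  assumes "Ck_on n S f" "open S"
  shows "continuous_on S f"
proof (cases n)
  case (Suc m)
  then have "\<forall>x\<in>S. isCont f x"
    using assms differentiable_imp_continuous_within by fastforce
  then show ?thesis by (rule continuous_at_imp_continuous_on)
qed (use assms in simp)

lemma Ck_on_SucD: "Ck_on (Suc n) S f \<Longrightarrow> open S \<Longrightarrow> Ck_on n S f"
proof (induction n arbitrary: f)
  case 0
  then show ?case using Ck_on_imp_continuous[OF 0] by simp
next
  case (Suc n)
  show ?case
    using Suc.prems Suc.IH[OF _ \<open>open S\<close>] unfolding Ck_on.simps(2)[of "Suc n"] Ck_on.simps(2)[of n S f]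
    by blast
qed

lemma Ck_on_const: "open S \<Longrightarrow> Ck_on n S (\<lambda>_. c)"
  by (induction n arbitrary: c) (auto intro!: Ck_on_Suc_intro)

lemma Ck_on_add:
  assumes "open S" "Ck_on n S f" "Ck_on n S g"
  shows "Ck_on n S (\<lambda>x. f x + g x)"
  using assms(2,3)
proof (induction n arbitrary: f g)
  case 0
  then show ?case by (auto intro: continuous_intros)
next
  case (Suc n)
  obtain f' where f': "\<And>x. x \<in> S \<Longrightarrow> (f has_derivative f' x) (at x)" "\<And>h. Ck_on n S (\<lambda>x. f' x h)"
    using Suc.prems(1) assms(1) by (rule Ck_on_Suc_elim) blast
  obtain g' where g': "\<And>x. x \<in> S \<Longrightarrow> (g has_derivative g' x) (at x)" "\<And>h. Ck_on n S (\<lambda>x. g' x h)"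
    using Suc.prems(2) assms(1) by (rule Ck_on_Suc_elim) blast
  show ?case
    by (rule Ck_on_Suc_intro[where f' = "\<lambda>x h. f' x h + g' x h"])
      (auto intro!: assms(1) derivative_eq_intros f' g' Suc.IH)
qed

lemma Ck_on_sum:
  assumes "open S" "finite I" "\<And>i. i \<in> I \<Longrightarrow> Ck_on n S (f i)"
  shows "Ck_on n S (\<lambda>x. \<Sum>i\<in>I. f i x)"
  using assms(2,3) by (induction I) (auto intro!: Ck_on_add Ck_on_const assms(1))

lemma Ck_on_bilinear:
  assumes "bounded_bilinear p" "open S" "Ck_on n S f" "Ck_on n S g"
  shows "Ck_on n S (\<lambda>x. p (f x) (g x))"
  using assms(3,4)
proof (induction n arbitrary: f g)
  case 0
  then show ?case using bounded_bilinear.continuous_on[OF assms(1)] by auto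
next
  case (Suc n)
  obtain f' where f': "\<And>x. x \<in> S \<Longrightarrow> (f has_derivative f' x) (at x)" "\<And>h. Ck_on n S (\<lambda>x. f' x h)"
    using Suc.prems(1) assms(2) by (rule Ck_on_Suc_elim) blast
  obtain g' where g': "\<And>x. x \<in> S \<Longrightarrow> (g has_derivative g' x) (at x)" "\<And>h. Ck_on n S (\<lambda>x. g' x h)"
    using Suc.prems(2) assms(2) by (rule Ck_on_Suc_elim) blast
  have "Ck_on n S f" "Ck_on n S g"
    using Suc.prems Ck_on_SucD assms(2) by blast+
  with f' g' show ?case
    by (intro Ck_on_Suc_intro[where f' = "\<lambda>x h. p (f x) (g' x h) + p (f' x h) (g x)"]
        assms(2) bounded_bilinear.FDERIV[OF assms(1)] Suc.IH Ck_on_add)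
qed

lemma Ck_on_inverse:
  fixes r :: "'a::euclidean_space \<Rightarrow> real"
  assumes "open S" "Ck_on n S r" "\<And>x. x \<in> S \<Longrightarrow> r x \<noteq> 0"
  shows "Ck_on n S (\<lambda>x. inverse (r x))"
  using assms(2,3)
proof (induction n arbitrary: r)
  case 0
  then show ?case by (auto intro: continuous_intros)
next
  case (Suc n)
  obtain r' where r': "\<And>x. x \<in> S \<Longrightarrow> (r has_derivative r' x) (at x)" "\<And>h. Ck_on n S (\<lambda>x. r' x h)"
    using Suc.prems(1) assms(1) by (rule Ck_on_Suc_elim) blast
  have inv: "Ck_on n S (\<lambda>x. inverse (r x))"
    using Suc Ck_on_SucD assms(1) by blast
  show ?case
  proof (rule Ck_on_Suc_intro[where f' = "\<lambda>x h. (-1) * ((inverse (r x) * inverse (r x)) * r' x h)"])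
    fix x assume "x \<in> S"
    then show "((\<lambda>x. inverse (r x)) has_derivative
        (\<lambda>h. (-1) * ((inverse (r x) * inverse (r x)) * r' x h))) (at x)"
      using Suc.prems by (auto intro!: derivative_eq_intros r')
  qed (intro assms(1) Ck_on_bilinear[OF bounded_bilinear_mult] Ck_on_const r' inv)+
qed

text \<open>\<open>Ck_on\<close> controls derivatives in fixed directions, while the chain rule
  evaluates \<open>f'\<close> in the moving direction \<open>g' x h\<close>. Expanding that
  direction over \<open>Basis\<close> leaves only fixed ones.\<close>

lemma Ck_on_compose:
  assumes "open S" "open T" "\<And>x. x \<in> T \<Longrightarrow> g x \<in> S" "Ck_on n S f" "Ck_on n T g"
  shows "Ck_on n T (\<lambda>x. f (g x))"
  using assms(4,5)
proof (induction n arbitrary: f)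
  case 0
  then show ?case using assms(3)
    by (auto intro!: continuous_on_compose2[of S f T g])
next
  case (Suc n)
  obtain f' where f': "\<And>x. x \<in> S \<Longrightarrow> (f has_derivative f' x) (at x)" "\<And>h. Ck_on n S (\<lambda>x. f' x h)"
    using Suc.prems(1) assms(1) by (rule Ck_on_Suc_elim) blast
  obtain g' where g': "\<And>x. x \<in> T \<Longrightarrow> (g has_derivative g' x) (at x)" "\<And>h. Ck_on n T (\<lambda>x. g' x h)"
    using Suc.prems(2) assms(2) by (rule Ck_on_Suc_elim) blast
  show ?case
  proof (rule Ck_on_Suc_intro[where f' = "\<lambda>x h. \<Sum>b\<in>Basis. (g' x h \<bullet> b) *\<^sub>R f' (g x) b"])
    fix x assume x: "x \<in> T"
    have "linear (f' (g x))" using f'(1)[OF assms(3)[OF x]] has_derivative_linear by blast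
    then have eq: "f' (g x) y = (\<Sum>b\<in>Basis. (y \<bullet> b) *\<^sub>R f' (g x) b)" for y
      using linear_sum[of "f' (g x)" "\<lambda>b. (y \<bullet> b) *\<^sub>R b" Basis] linear_cmul[of "f' (g x)"]
      by (simp add: euclidean_representation)
    then show "((\<lambda>x. f (g x)) has_derivative (\<lambda>h. \<Sum>b\<in>Basis. (g' x h \<bullet> b) *\<^sub>R f' (g x) b)) (at x)"
      using has_derivative_compose[OF g'(1)[OF x] f'(1)[OF assms(3)[OF x]]] by (subst (asm) eq)
  next
    fix h
    show "Ck_on n T (\<lambda>x. \<Sum>b\<in>Basis. (g' x h \<bullet> b) *\<^sub>R f' (g x) b)"
      by (intro Ck_on_sum assms(2) finite_Basis Ck_on_bilinear[OF bounded_bilinear_scaleR]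
          Ck_on_bilinear[OF bounded_bilinear_inner] g' Ck_on_const Suc.IH f' Ck_on_SucD[OF Suc.prems(2)])
  qed (fact assms(2))
qed

text \<open>Invariance of domain makes the image open and the inverse continuous. The derivative of
  the inverse at \<open>y\<close> is \<open>g'\<close> at the preimage of \<open>y\<close>, so each
  order of smoothness of the inverse yields the next.\<close>

lemma smooth_inv_into:
  fixes f :: "'a::euclidean_space \<Rightarrow> 'b::euclidean_space"
  assumes "open S" "inj_on f S" "DIM('a) = DIM('b)"
    and f': "\<And>x. x \<in> S \<Longrightarrow> (f has_derivative f' x) (at x)"
    and g': "\<And>x. x \<in> S \<Longrightarrow> bounded_linear (g' x)" "\<And>x h. x \<in> S \<Longrightarrow> g' x (f' x h) = h"
      "\<And>n h. Ck_on n S (\<lambda>x. g' x h)"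
  shows "open (f ` S)" "smooth_on (f ` S) (inv_into S f)"
proof -
  have cont: "continuous_on S f"
    using f' has_derivative_continuous continuous_at_imp_continuous_on by blast
  show op: "open (f ` S)"
    using invariance_of_domain_gen[OF \<open>open S\<close> cont] assms by simp
  obtain k where k: "homeomorphism S (f ` S) f k"
    using invariance_of_domain_homeomorphism[OF \<open>open S\<close> cont] assms by auto
  let ?g = "inv_into S f"
  have "continuous_on (f ` S) ?g"
    using k assms(2) by (auto simp: homeomorphism_def intro!: continuous_on_eq[of "f ` S" k])
  then have cg: "continuous (at y) ?g" if "y \<in> f ` S" for y
    using that op continuous_on_eq_continuous_at by blast
  have gin: "?g y \<in> S" if "y \<in> f ` S" for y using that by (rule inv_into_into)
  have dg: "(?g has_derivative g' (?g y)) (at y)" if y: "y \<in> f ` S" for y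
  proof (rule has_derivative_inverse_basic[OF _ _ _ cg[OF y] op y])
    show "(f has_derivative f' (?g y)) (at (?g y))" using f' gin y by blast
    show "bounded_linear (g' (?g y))" using g' gin y by blast
    show "g' (?g y) \<circ> f' (?g y) = id" using g' gin y by (auto simp: fun_eq_iff)
  qed (rule f_inv_into_f)
  have "Ck_on n (f ` S) ?g" for n
  proof (induction n)
    case 0
    then show ?case using \<open>continuous_on (f ` S) ?g\<close> by simp
  next
    case (Suc n)
    show ?case
      by (rule Ck_on_Suc_intro[OF op, where f' = "\<lambda>y. g' (?g y)"])
        (use Suc dg g' gin assms(1) op in \<open>auto intro!: Ck_on_compose[of S, where g = ?g]\<close>)
  qed
  then show "smooth_on (f ` S) ?g" by (simp add: smooth_on_def)
qed

section \<open>The flow of a planar linear vector field with real eigenvalues\<close>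

locale planar_flow =
  fixes B :: "real^2^2" and \<mu>1 \<mu>2 :: real
  assumes char_eq: "B *v (B *v v) = (\<mu>1 + \<mu>2) *\<^sub>R (B *v v) - (\<mu>1 * \<mu>2) *\<^sub>R v"
    and le: "\<mu>2 \<le> \<mu>1" and neg: "\<mu>1 < 0"
begin

text \<open>\<open>flow t\<close> is \<open>e\<^bsup>tB\<^esup>\<close>, which is linear in \<open>B\<close> because \<open>(B - \<mu>1)(B - \<mu>2) = 0\<close>.\<close>

definition q :: "real \<Rightarrow> real" where
  "q t = (if \<mu>1 = \<mu>2 then t * exp (\<mu>1 * t) else (exp (\<mu>1 * t) - exp (\<mu>2 * t)) / (\<mu>1 - \<mu>2))"

definition flow :: "real \<Rightarrow> real^2 \<Rightarrow> real^2" where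
  "flow t v = exp (\<mu>1 * t) *\<^sub>R v + q t *\<^sub>R (B *v v - \<mu>1 *\<^sub>R v)"

lemma q_0 [simp]: "q 0 = 0"
  by (simp add: q_def)

lemma q_deriv: "(q has_real_derivative \<mu>2 * q t + exp (\<mu>1 * t)) (at t)"
proof (cases "\<mu>1 = \<mu>2")
  case True
  have "q = (\<lambda>t. t * exp (\<mu>1 * t))" unfolding fun_eq_iff q_def using True by simp
  with True show ?thesis by (auto intro!: derivative_eq_intros)
next
  case False
  then have q: "q = (\<lambda>t. (exp (\<mu>1 * t) - exp (\<mu>2 * t)) / (\<mu>1 - \<mu>2))" by (auto simp: q_def)
  have "(q has_real_derivative (\<mu>1 * exp (\<mu>1 * t) - \<mu>2 * exp (\<mu>2 * t)) / (\<mu>1 - \<mu>2)) (at t)"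
    unfolding q by (rule DERIV_cdivide) (auto intro!: derivative_eq_intros)
  moreover have "(\<mu>1 * exp (\<mu>1 * t) - \<mu>2 * exp (\<mu>2 * t)) / (\<mu>1 - \<mu>2) = \<mu>2 * q t + exp (\<mu>1 * t)"
    using False by (simp add: q field_simps)
  ultimately show ?thesis by simp
qed

lemma q_add: "q (s + t) = exp (\<mu>1 * s) * q t + q s * exp (\<mu>1 * t) + (\<mu>2 - \<mu>1) * (q s * q t)"
proof (cases "\<mu>1 = \<mu>2")
  case True
  have "q r = r * exp (\<mu>1 * r)" for r unfolding q_def using True by simp
  with True show ?thesis by (simp add: algebra_simps exp_add)
next
  case False
  define k where "k = \<mu>1 - \<mu>2"
  have "k \<noteq> 0" using False by (simp add: k_def)
  have q: "q r = (exp (\<mu>1 * r) - exp (\<mu>2 * r)) / k" for r using False by (simp add: q_def k_def)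
  have "\<mu>2 - \<mu>1 = -k" by (simp add: k_def)
  show ?thesis unfolding q \<open>\<mu>2 - \<mu>1 = -k\<close>
    using \<open>k \<noteq> 0\<close> by (simp add: field_simps exp_add)
qed

lemma q_tendsto_0: "(q \<longlongrightarrow> 0) at_top"
proof (cases "\<mu>1 = \<mu>2")
  case True
  have "((\<lambda>t. t * exp (\<mu>1 * t)) \<longlongrightarrow> 0) at_top" using neg by real_asymp
  moreover have "q = (\<lambda>t. t * exp (\<mu>1 * t))" unfolding fun_eq_iff q_def using True by simp
  ultimately show ?thesis by simp
next
  case False
  have "((\<lambda>t. exp (m * t)) \<longlongrightarrow> 0) at_top" if "m < 0" for m :: real using that by real_asymp
  from tendsto_divide[OF tendsto_diff[OF this[of \<mu>1] this[of \<mu>2]] tendsto_const[of "\<mu>1 - \<mu>2"]]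
  show ?thesis using neg le False by (simp add: q_def[abs_def])
qed

lemma flow_0 [simp]: "flow 0 v = v"
  by (simp add: flow_def)

lemma linear_flow: "linear (flow t)"
  unfolding flow_def
  by (intro linearI) (simp_all add: algebra_simps matrix_vector_right_distrib matrix_vector_mult_scaleR)

lemma flow_diff: "flow t (v - w) = flow t v - flow t w"
  using linear_flow linear_diff by blast

lemma flow_lincomb: "flow t v + flow t w = flow t (v + w)" "flow t (c *\<^sub>R v) = c *\<^sub>R flow t v"
  "flow t (- v) = - flow t v" "flow t 0 = 0"
  using linear_flow linear_add linear_cmul linear_neg linear_0 by metis+

lemma matrix_flow: "B *v flow t v = flow t (B *v v)"
  by (simp add: flow_def char_eq algebra_simps matrix_vector_right_distrib matrix_vector_mult_scaleR
      matrix_vector_mult_diff_distrib)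

lemma flow_add: "flow (s + t) v = flow s (flow t v)"
proof -
  \<comment> \<open>\<open>N\<close> is annihilated by \<open>B - \<mu>2\<close>, so the flow scales
    it by \<open>exp (\<mu>1 * s) + (\<mu>2 - \<mu>1) * q s\<close>, which equals
    \<open>exp (\<mu>2 * s)\<close>.\<close>
  define N where "N = B *v v - \<mu>1 *\<^sub>R v"
  have "B *v N = \<mu>2 *\<^sub>R N"
    by (simp add: N_def char_eq algebra_simps matrix_vector_mult_scaleR matrix_vector_mult_diff_distrib)
  then have N: "flow s N = (exp (\<mu>1 * s) + (\<mu>2 - \<mu>1) * q s) *\<^sub>R N"
    by (simp add: flow_def algebra_simps)
  have f: "flow r v = exp (\<mu>1 * r) *\<^sub>R v + q r *\<^sub>R N" for r
    by (simp add: flow_def N_def)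
  have "flow s (flow t v) = exp (\<mu>1 * t) *\<^sub>R flow s v + q t *\<^sub>R flow s N"
    unfolding f[of t] flow_lincomb(1)[symmetric] flow_lincomb(2) ..
  then show ?thesis unfolding N f q_add
    by (simp add: algebra_simps exp_add)
qed

lemma flow_minus [simp]: "flow (- t) (flow t v) = v" "flow t (flow (- t) v) = v"
  by (simp_all flip: flow_add)

text \<open>Time and point both vary: this serves to show that a pulled-back trajectory is constant
  and to verify variation of constants.\<close>

lemma flow_deriv:
  assumes "(z has_vector_derivative z') (at t within S)"
    and "(r has_real_derivative r') (at t within S)"
  shows "((\<lambda>t. flow (r t) (z t)) has_vector_derivative (r' *\<^sub>R flow (r t) (B *v z t) + flow (r t) z')) (at t within S)"
proof -
  have B: "((\<lambda>t. B *v z t) has_vector_derivative B *v z') (at t within S)"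
    by (rule bounded_linear.has_vector_derivative[OF _ assms(1)]) (rule matrix_vector_mul_bounded_linear)
  have "((\<lambda>t. q (r t)) has_real_derivative (\<mu>2 * q (r t) + exp (\<mu>1 * r t)) * r') (at t within S)"
    by (rule DERIV_chain2[OF q_deriv assms(2)])
  moreover have "((\<lambda>t. exp (\<mu>1 * r t)) has_real_derivative (exp (\<mu>1 * r t) * (\<mu>1 * r'))) (at t within S)"
    by (auto intro!: derivative_eq_intros assms)
  ultimately have "((\<lambda>t. flow (r t) (z t)) has_vector_derivative
      ((exp (\<mu>1 * r t) *\<^sub>R z' + (exp (\<mu>1 * r t) * (\<mu>1 * r')) *\<^sub>R z t)
      + (q (r t) *\<^sub>R (B *v z' - \<mu>1 *\<^sub>R z')
      + ((\<mu>2 * q (r t) + exp (\<mu>1 * r t)) * r') *\<^sub>R (B *v z t - \<mu>1 *\<^sub>R z t)))) (at t within S)"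
    unfolding flow_def
    by (intro has_vector_derivative_add has_vector_derivative_scaleR has_vector_derivative_diff B assms
        bounded_linear.has_vector_derivative[OF bounded_linear_scaleR_right])
  then show ?thesis
    by (rule has_vector_derivative_eq_rhs) (simp add: flow_def char_eq algebra_simps)
qed

lemma flow_has_vector_derivative: "((\<lambda>t. flow t v) has_vector_derivative flow t (B *v v)) (at t within S)"
  using flow_deriv[of "\<lambda>_. v" 0 t S "\<lambda>t. t" 1] by (simp add: flow_lincomb)

lemma continuous_flow [continuous_intros]:
  assumes "continuous_on S r" "continuous_on S z"
  shows "continuous_on S (\<lambda>x. flow (r x) (z x))"
proof -
  have "continuous_on UNIV q" using q_deriv DERIV_isCont continuous_at_imp_continuous_on by blast
  from continuous_on_compose2[OF this assms(1)] show ?thesis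
    unfolding flow_def
    by (auto intro!: continuous_intros assms bounded_linear.continuous_on[OF matrix_vector_mul_bounded_linear])
qed

text \<open>The rate \<open>\<kappa>\<close> is uniform in \<open>v\<close>; the synchronization
  argument applies it to vectors that depend on the elapsed time.\<close>

lemma flow_bound:
  obtains \<kappa> where "(\<kappa> \<longlongrightarrow> 0) at_top" "\<And>t v. norm (flow t v) \<le> \<kappa> t * norm v"
proof -
  have "bounded_linear (\<lambda>v. B *v v - \<mu>1 *\<^sub>R v)"
    by (intro bounded_linear_sub matrix_vector_mul_bounded_linear bounded_linear_scaleR_right)
  then obtain C where C: "\<And>v. norm (B *v v - \<mu>1 *\<^sub>R v) \<le> norm v * C"
    using bounded_linear.bounded by blast
  let ?\<kappa> = "\<lambda>t. exp (\<mu>1 * t) + \<bar>q t\<bar> * C"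
  have "((\<lambda>t. exp (\<mu>1 * t)) \<longlongrightarrow> 0) at_top" using neg by real_asymp
  moreover have "((\<lambda>t. \<bar>q t\<bar> * C) \<longlongrightarrow> 0 * C) at_top"
    by (intro tendsto_mult tendsto_rabs_zero q_tendsto_0 tendsto_const)
  ultimately have "(?\<kappa> \<longlongrightarrow> 0) at_top" using tendsto_add by fastforce
  moreover have "norm (flow t v) \<le> ?\<kappa> t * norm v" for t v
  proof -
    have "norm (flow t v) \<le> exp (\<mu>1 * t) * norm v + \<bar>q t\<bar> * norm (B *v v - \<mu>1 *\<^sub>R v)"
      unfolding flow_def by (rule order_trans[OF norm_triangle_ineq]) simp
    also have "\<dots> \<le> exp (\<mu>1 * t) * norm v + \<bar>q t\<bar> * (norm v * C)"
      by (intro add_left_mono mult_left_mono C) auto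
    finally show ?thesis by (simp add: algebra_simps)
  qed
  ultimately show ?thesis using that by blast
qed

lemma flow_tendsto_0: "((\<lambda>t. flow t v) \<longlongrightarrow> 0) at_top"
proof -
  obtain \<kappa> where \<kappa>: "(\<kappa> \<longlongrightarrow> 0) at_top" "\<And>t v. norm (flow t v) \<le> \<kappa> t * norm v"
    using flow_bound by blast
  have "((\<lambda>t. \<kappa> t * norm v) \<longlongrightarrow> 0) at_top" using tendsto_mult_right[OF \<kappa>(1), of "norm v"] by simp
  then show ?thesis by (rule Lim_null_comparison[rotated]) (use \<kappa> in auto)
qed

text \<open>Up to the scalar \<open>l h\<close>, the directional derivative has the same form with
  \<open>B *v v\<close> in place of \<open>v\<close>, so the induction over all \<open>v\<close>
  closes up.\<close>

lemma Ck_on_flow: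
  assumes "bounded_linear l" "open S"
  shows "Ck_on n S (\<lambda>x. flow (l x) v)"
proof (induction n arbitrary: v)
  case 0
  then show ?case
    using assms by (simp add: continuous_intros linear_continuous_on)
next
  case (Suc n)
  have eq: "flow (l x) (l h *\<^sub>R (B *v v)) = l h *\<^sub>R flow (l x) (B *v v)" for x h
    by (simp add: flow_lincomb)
  show ?case
  proof (rule Ck_on_Suc_intro[where f' = "\<lambda>x h. flow (l x) (l h *\<^sub>R (B *v v))"])
    fix x
    have "((\<lambda>t. flow t v) has_derivative (\<lambda>h. h *\<^sub>R flow (l x) (B *v v))) (at (l x))"
      using flow_has_vector_derivative[of v "l x" UNIV] by (simp add: has_vector_derivative_def)
    from has_derivative_compose[OF bounded_linear_imp_has_derivative[OF assms(1)] this]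
    show "((\<lambda>x. flow (l x) v) has_derivative (\<lambda>h. flow (l x) (l h *\<^sub>R (B *v v)))) (at x)"
      by (simp add: eq)
  qed (use assms Suc in auto)
qed

end

section \<open>The lens between two arcs\<close>

locale lens =
  fixes h h' :: "real \<Rightarrow> real"
  assumes h_cont: "continuous_on {0..1} h"
    and h_deriv: "\<And>x. 0 < x \<Longrightarrow> x < 1 \<Longrightarrow> (h has_real_derivative h' x) (at x)"
    and h'_less: "\<And>x y. 0 < x \<Longrightarrow> x < y \<Longrightarrow> y < 1 \<Longrightarrow> h' y < h' x"
    and h_ends: "h 0 = 0" "h 1 = 0"
begin

text \<open>Chords of the graph of \<open>h\<close>: \<open>c\<close> is the horizontal width,
  \<open>d\<close> the rise. The two bounds are the rises of the chords ending at 1 and starting at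
  0.\<close>

definition lens :: "(real \<times> real) set" where
  "lens = {(c, d). 0 < c \<and> c < 1 \<and> - h (1 - c) < d \<and> d < h c}"

lemma lens_symmetric: "(c, d) \<in> lens \<Longrightarrow> (1 - c, - d) \<in> lens"
  by (auto simp: lens_def)

text \<open>The rise of a chord of width \<open>c\<close> has derivative
  \<open>h' (y + c) - h' y\<close>, negative by \<open>h'_less\<close>; at the endpoints 0 and 1
  continuity suffices.\<close>

lemma chord_strict_decreasing:
  assumes "0 < c" "0 \<le> y" "y < z" "z + c \<le> 1"
  shows "h (z + c) - h z < h (y + c) - h y"
proof (rule DERIV_neg_imp_decreasing_open[OF \<open>y < z\<close>, where f = "\<lambda>y. h (y + c) - h y"])
  show "continuous_on {y..z} (\<lambda>y. h (y + c) - h y)"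
    using assms by (intro continuous_intros continuous_on_compose2[OF h_cont]) auto
  fix x assume x: "y < x" "x < z"
  then have "((\<lambda>y. h (y + c) - h y) has_real_derivative h' (x + c) * 1 - h' x) (at x)"
    using assms by (intro DERIV_diff DERIV_chain2[where g = "\<lambda>y. y + c"] h_deriv)
      (auto intro!: derivative_eq_intros)
  moreover have "h' (x + c) * 1 - h' x < 0" using h'_less[of x "x + c"] x assms by simp
  ultimately show "\<exists>y. ((\<lambda>y. h (y + c) - h y) has_real_derivative y) (at x) \<and> y < 0" by blast
qed

lemma lens_coordinates_inj:
  assumes "0 < y" "y < x" "x < 1" "0 < y'" "y' < x'" "x' < 1"
    and "x - y = x' - y'" "h x - h y = h x' - h y'"
  shows "x = x'" "y = y'"
proof -
  define c where "c = x - y"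
  have x: "x = y + c" "x' = y' + c" using assms by (auto simp: c_def)
  have "\<not> y < y'" "\<not> y' < y"
    using chord_strict_decreasing[of c y y'] chord_strict_decreasing[of c y' y] assms
    unfolding x by auto
  then show "y = y'" by simp
  then show "x = x'" using assms by simp
qed

text \<open>For fixed width \<open>c\<close> the rise falls continuously from \<open>h c\<close> at
  \<open>y = 0\<close> to \<open>- h (1 - c)\<close> at \<open>y = 1 - c\<close>. Strictness
  excludes both extremes, and the intermediate value theorem gives everything between.\<close>

lemma lens_coordinates: "(\<lambda>(x, y). (x - y, h x - h y)) ` {(x, y). 0 < y \<and> y < x \<and> x < 1} = lens"
proof (intro equalityI subsetI)
  fix p assume "p \<in> (\<lambda>(x, y). (x - y, h x - h y)) ` {(x, y). 0 < y \<and> y < x \<and> x < 1}"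
  then obtain x y where p: "p = (x - y, h x - h y)" and xy: "0 < y" "y < x" "x < 1" by auto
  have "h x - h y < h (x - y)"
    using chord_strict_decreasing[of "x - y" 0 y] xy h_ends by simp
  moreover have "- h (1 - (x - y)) < h x - h y"
    using chord_strict_decreasing[of "x - y" y "1 - (x - y)"] xy h_ends by simp
  ultimately show "p \<in> lens" using xy by (simp add: lens_def p)
next
  fix p assume "p \<in> lens"
  then obtain c d where p: "p = (c, d)" and cd: "0 < c" "c < 1" "- h (1 - c) < d" "d < h c"
    by (auto simp: lens_def)
  let ?k = "\<lambda>y. h (y + c) - h y"
  have "continuous_on {0..1 - c} ?k"
    using cd by (intro continuous_intros continuous_on_compose2[OF h_cont]) auto
  moreover have "?k (1 - c) \<le> d" "d \<le> ?k 0" using cd h_ends by auto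
  ultimately obtain y where y: "0 \<le> y" "y \<le> 1 - c" "?k y = d"
    using IVT2'[of ?k "1 - c" d 0] cd by auto
  have "y \<noteq> 0" "y \<noteq> 1 - c" using y cd h_ends by auto
  then show "p \<in> (\<lambda>(x, y). (x - y, h x - h y)) ` {(x, y). 0 < y \<and> y < x \<and> x < 1}"
    using y cd by (intro image_eqI[where x = "(y + c, y)"]) (auto simp: p)
qed

lemma concave_h:
  assumes "0 < x" "x < 1" "0 < y" "y < 1" "0 \<le> u" "0 \<le> v" "u + v = 1"
  shows "u * h x + v * h y \<le> h (u * x + v * y)"
proof -
  have "convex_on {0<..<1} (\<lambda>x. - h x)"
  proof (rule convex_on_realI[where f' = "\<lambda>x. - h' x"])
    show "- h' x \<le> - h' y" if "x \<in> {0<..<1}" "y \<in> {0<..<1}" "x \<le> y" for x y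
      using that h'_less[of x y] by (cases "x = y") auto
  qed (auto intro!: DERIV_minus h_deriv)
  from convex_onD[OF this, of v x y] show ?thesis
    using assms unfolding eq_diff_eq[symmetric] by simp
qed

text \<open>The upper boundary is concave in \<open>c\<close>, the lower one convex. Strict
  inequalities survive because one of the weights is positive.\<close>

lemma convex_lens: "convex lens"
proof (rule convexI)
  fix p p' :: "real \<times> real" and u v :: real
  assume pp: "p \<in> lens" "p' \<in> lens" and uv: "0 \<le> u" "0 \<le> v" "u + v = 1"
  obtain c d c' d' where p: "p = (c, d)" "p' = (c', d')" by fastforce
  have b: "0 < c" "c < 1" "0 < c'" "c' < 1" using pp by (auto simp: p lens_def)
  have less: "u * a + v * a' < u * b + v * b'" if "a < b" "a' < b'" for a a' b b'
    using uv that by (cases "u = 0") (auto intro!: add_less_le_mono mult_left_mono)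
  have "1 - (u * c + v * c') = u * (1 - c) + v * (1 - c')"
    using uv by (simp add: algebra_simps)
  then have "- h (1 - (u * c + v * c')) \<le> u * (- h (1 - c)) + v * (- h (1 - c'))"
    using concave_h[of "1 - c" "1 - c'" u v] b uv by simp
  also have "\<dots> < u * d + v * d'" using pp by (intro less) (auto simp: p lens_def)
  finally have "- h (1 - (u * c + v * c')) < u * d + v * d'" .
  moreover have "u * d + v * d' < h (u * c + v * c')"
    by (rule less_le_trans[OF less concave_h]) (use pp b uv in \<open>auto simp: p lens_def\<close>)
  moreover have "0 < u * c + v * c'" "u * c + v * c' < 1"
    using less[of 0 c 0 c'] less[of c 1 c' 1] b uv by auto
  ultimately show "u *\<^sub>R p + v *\<^sub>R p' \<in> lens" by (simp add: p lens_def)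
qed

end

section \<open>The trajectory arc as a strictly concave graph\<close>

context planar_flow
begin

text \<open>\<open>q\<close> in the variable \<open>x = exp (\<mu>1 * t)\<close>, for which
  \<open>exp (\<mu>2 * t)\<close> becomes \<open>x powr (\<mu>2 / \<mu>1)\<close>.\<close>

definition h :: "real \<Rightarrow> real" where
  "h x = (if \<mu>1 = \<mu>2 then x * ln x / \<mu>1 else (x - x powr (\<mu>2 / \<mu>1)) / (\<mu>1 - \<mu>2))"

definition h' :: "real \<Rightarrow> real" where
  "h' x = (if \<mu>1 = \<mu>2 then (ln x + 1) / \<mu>1 else (1 - \<mu>2 / \<mu>1 * x powr (\<mu>2 / \<mu>1 - 1)) / (\<mu>1 - \<mu>2))"

lemma h_exp: "h (exp (\<mu>1 * t)) = q t"
  using neg by (simp add: h_def q_def powr_def)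

sublocale lens h h'
proof
  \<comment> \<open>The point 0 stands for infinite time; \<open>0 * ln 0 = 0\<close> and
    \<open>0 powr a = 0\<close> already give the limiting value there.\<close>
  show "h 0 = 0" "h 1 = 0" by (simp_all add: h_def)
  have k: "1 < \<mu>2 / \<mu>1" if "\<mu>1 \<noteq> \<mu>2" using that le neg by (simp add: divide_simps)
  show d: "(h has_real_derivative h' x) (at x)" if "0 < x" for x
  proof (cases "\<mu>1 = \<mu>2")
    case True
    have "((\<lambda>x. x * ln x / \<mu>1) has_real_derivative (ln x + 1) / \<mu>1) (at x)"
      using that by (intro DERIV_cdivide) (auto intro!: derivative_eq_intros)
    moreover have "h = (\<lambda>x. x * ln x / \<mu>1)" unfolding fun_eq_iff h_def using True by simp
    ultimately show ?thesis unfolding h'_def using True by simp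
  next
    case False
    have "((\<lambda>x. (x - x powr (\<mu>2 / \<mu>1)) / (\<mu>1 - \<mu>2)) has_real_derivative
       (1 - \<mu>2 / \<mu>1 * x powr (\<mu>2 / \<mu>1 - 1)) / (\<mu>1 - \<mu>2)) (at x)"
      using that by (intro DERIV_cdivide DERIV_diff DERIV_ident has_real_derivative_powr)
    then show ?thesis using False by (simp add: h_def[abs_def] h'_def)
  qed
  show "h' y < h' x" if "0 < x" "x < y" for x y
  proof (cases "\<mu>1 = \<mu>2")
    case True
    then show ?thesis unfolding h'_def using neg that by (simp add: divide_strict_right_mono_neg)
  next
    case False
    have "x powr (\<mu>2 / \<mu>1 - 1) < y powr (\<mu>2 / \<mu>1 - 1)"
      using k[OF False] that by (intro powr_less_mono2) auto
    then have "\<mu>2 / \<mu>1 * x powr (\<mu>2 / \<mu>1 - 1) < \<mu>2 / \<mu>1 * y powr (\<mu>2 / \<mu>1 - 1)"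
      using k[OF False] by (intro mult_strict_left_mono) auto
    then show ?thesis using False le unfolding h'_def by (simp add: divide_strict_right_mono)
  qed
  have "isCont h x" if "0 < x" for x using d[OF that] by (rule DERIV_isCont)
  then have c: "continuous (at x within {0..1}) h" if "0 < x" for x
    using that continuous_at_imp_continuous_at_within by blast
  have "(h \<longlongrightarrow> h 0) (at_right 0)"
  proof (cases "\<mu>1 = \<mu>2")
    case True
    have "((\<lambda>x. x * ln x / \<mu>1) \<longlongrightarrow> 0) (at_right 0)" using neg by real_asymp
    moreover have "h = (\<lambda>x. x * ln x / \<mu>1)" unfolding fun_eq_iff h_def using True by simp
    ultimately show ?thesis by simp
  next
    case False
    have "((\<lambda>x. x powr k) \<longlongrightarrow> 0) (at_right 0)" if "0 < k" for k :: real using that by real_asymp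
    from this[of "\<mu>2 / \<mu>1"] k[OF False]
    have "((\<lambda>x. (x - x powr (\<mu>2 / \<mu>1)) / (\<mu>1 - \<mu>2)) \<longlongrightarrow> (0 - 0) / (\<mu>1 - \<mu>2)) (at_right 0)"
      using False by (intro tendsto_intros) auto
    then show ?thesis using False by (simp add: h_def[abs_def])
  qed
  then have "(h \<longlongrightarrow> h 0) (at 0 within {0..1})"
    by (simp add: at_within_Icc_at_right)
  then show "continuous_on {0..1} h"
    using c unfolding continuous_on_eq_continuous_within
    by (metis atLeastAtMost_iff continuous_within order_le_less)
qed

end

section \<open>Planar determinants\<close>

definition cross :: "real^2 \<Rightarrow> real^2 \<Rightarrow> real" where
  "cross x y = x $ 1 * y $ 2 - x $ 2 * y $ 1"

lemma bounded_bilinear_cross: "bounded_bilinear cross"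
  by (rule bilinear_conv_bounded_bilinear[THEN iffD1])
    (auto simp: bilinear_def cross_def algebra_simps intro!: linearI)

lemma cross_linear:
  assumes "linear f"
  shows "cross (f x) (f y) = det (matrix f) * cross x y"
proof -
  have "cross (M *v x) (M *v y) = det M * cross x y" for M
    by (simp add: cross_def det_2 matrix_vector_mult_def sum_2 algebra_simps)
  from this[of "matrix f"] show ?thesis by (simp add: fun_cong[OF matrix_vector_mul(2)[OF assms]])
qed

lemma cross_algebra:
  "cross (x + y) z = cross x z + cross y z" "cross x (y + z) = cross x y + cross x z"
  "cross (x - y) z = cross x z - cross y z" "cross x (y - z) = cross x y - cross x z"
  "cross (c *\<^sub>R x) y = c * cross x y" "cross x (c *\<^sub>R y) = c * cross x y"
  "cross x x = 0" "cross (- x) y = - cross x y" "cross x (- y) = - cross x y"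
  by (simp_all add: cross_def algebra_simps)

lemma cross_commute: "cross y x = - cross x y"
  by (simp add: cross_def)

text \<open>Only the multiple of \<open>v\<close> in \<open>char_eq\<close> survives the alternating
  form. As \<open>\<mu>1 * \<mu>2\<close> is nonzero, independence passes between the pairs
  \<open>v\<close>, \<open>B *v v\<close> and \<open>B *v v\<close>,
  \<open>B *v (B *v v)\<close>.\<close>

lemma (in planar_flow) cross_matrix: "cross (B *v v) (B *v (B *v v)) = \<mu>1 * \<mu>2 * cross v (B *v v)"
  using cross_commute[of "B *v v" v] by (simp add: char_eq cross_algebra)

section \<open>The switching map and its image\<close>

locale switching = planar_flow +
  fixes w e :: "real^2"
  assumes indep: "cross w (B *v w) \<noteq> 0"
begin

abbreviation Q where "Q \<equiv> {0<..} \<times> {0<..} :: (real \<times> real) set"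

definition F :: "real \<times> real \<Rightarrow> real^2" where
  "F p = e + flow (fst p) w - flow (fst p + snd p) w"

definition G :: "(real^2) set" where "G = F ` Q"

definition coord :: "real \<times> real \<Rightarrow> real^2" where
  "coord p = e + fst p *\<^sub>R w + snd p *\<^sub>R (B *v w - \<mu>1 *\<^sub>R w)"

lemma inj_coord: "inj coord"
proof (rule injI)
  fix x y assume "coord x = coord y"
  then have "(fst x - fst y) *\<^sub>R w + (snd x - snd y) *\<^sub>R (B *v w - \<mu>1 *\<^sub>R w) = 0"
    by (simp add: coord_def algebra_simps)
  then have "cross ((fst x - fst y) *\<^sub>R w + (snd x - snd y) *\<^sub>R (B *v w - \<mu>1 *\<^sub>R w)) w = 0"
    "cross ((fst x - fst y) *\<^sub>R w + (snd x - snd y) *\<^sub>R (B *v w - \<mu>1 *\<^sub>R w)) (B *v w - \<mu>1 *\<^sub>R w) = 0"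
    by (simp_all add: cross_def)
  then have "snd x = snd y" "fst x = fst y"
    using indep cross_commute[of "B *v w" w] by (auto simp: cross_algebra)
  then show "x = y" by (simp add: prod_eq_iff)
qed

lemma F_coord: "F (s, t) = coord (exp (\<mu>1 * s) - exp (\<mu>1 * (s + t)),
    h (exp (\<mu>1 * s)) - h (exp (\<mu>1 * (s + t))))"
  unfolding h_exp by (simp add: F_def coord_def flow_def algebra_simps)

lemma exp_param: "(\<lambda>(s, t). (exp (\<mu>1 * s), exp (\<mu>1 * (s + t)))) ` Q = {(x, y). 0 < y \<and> y < x \<and> x < 1}"
proof (intro equalityI subsetI)
  fix p :: "real \<times> real" assume "p \<in> {(x, y). 0 < y \<and> y < x \<and> x < 1}"
  then obtain x y where p: "p = (x, y)" "0 < y" "y < x" "x < 1" by auto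
  have "ln y < ln x" "ln x < 0" using p by auto
  then have "(ln x / \<mu>1, ln y / \<mu>1 - ln x / \<mu>1) \<in> Q"
    using neg by (auto simp: divide_simps)
  moreover have "p = (\<lambda>(s, t). (exp (\<mu>1 * s), exp (\<mu>1 * (s + t)))) (ln x / \<mu>1, ln y / \<mu>1 - ln x / \<mu>1)"
    using p neg by simp
  ultimately show "p \<in> (\<lambda>(s, t). (exp (\<mu>1 * s), exp (\<mu>1 * (s + t)))) ` Q" by blast
qed (use neg in \<open>auto simp: mult_neg_pos\<close>)

lemma G_eq: "G = coord ` lens"
proof -
  have "F = coord \<circ> (\<lambda>(x, y). (x - y, h x - h y)) \<circ> (\<lambda>(s, t). (exp (\<mu>1 * s), exp (\<mu>1 * (s + t))))"
    by (auto simp: fun_eq_iff F_coord)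
  then show ?thesis
    unfolding G_def lens_coordinates[symmetric] exp_param[symmetric] by (simp only: image_comp comp_assoc)
qed

lemma inj_on_F: "inj_on F Q"
proof (rule inj_onI)
  fix a b assume ab: "a \<in> Q" "b \<in> Q" "F a = F b"
  obtain s t s' t' where st: "a = (s, t)" "b = (s', t')" by fastforce
  have "exp (\<mu>1 * s) = exp (\<mu>1 * s') \<and> exp (\<mu>1 * (s + t)) = exp (\<mu>1 * (s' + t'))"
    using ab injD[OF inj_coord, of "(exp (\<mu>1 * s) - exp (\<mu>1 * (s + t)), h (exp (\<mu>1 * s)) - h (exp (\<mu>1 * (s + t))))"
      "(exp (\<mu>1 * s') - exp (\<mu>1 * (s' + t')), h (exp (\<mu>1 * s')) - h (exp (\<mu>1 * (s' + t'))))"] neg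
    by (intro conjI; intro lens_coordinates_inj[of "exp (\<mu>1 * (s + t))" "exp (\<mu>1 * s)" "exp (\<mu>1 * (s' + t'))" "exp (\<mu>1 * s')"])
      (auto simp: st F_coord mult_neg_pos)
  then show "a = b" using neg by (auto simp: st)
qed

lemma convex_G: "convex G"
proof -
  have "G = (\<lambda>z. e + z) ` (\<lambda>p. fst p *\<^sub>R w + snd p *\<^sub>R (B *v w - \<mu>1 *\<^sub>R w)) ` lens"
    by (simp add: G_eq coord_def image_image add.assoc)
  then show ?thesis
    by (simp only:) (intro convex_translation convex_linear_image convex_lens linearI;
      simp add: algebra_simps)
qed

text \<open>In lens coordinates, reflection in the midpoint of the equilibria \<open>e\<close> and
  \<open>e + w\<close> is \<open>(c, d) \<mapsto> (1 - c, - d)\<close>.\<close>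

lemma G_symmetric: "z \<in> G \<Longrightarrow> e + (e + w) - z \<in> G"
proof -
  assume "z \<in> G"
  then obtain c d where cd: "(c, d) \<in> lens" "z = coord (c, d)" by (auto simp: G_eq)
  have "e + (e + w) - z = coord (1 - c, - d)" by (simp add: cd coord_def algebra_simps)
  then show ?thesis using lens_symmetric[OF cd(1)] by (auto simp: G_eq)
qed

lemma G_flow_lower:
  assumes "z \<in> G" "0 \<le> r"
  shows "flow r (z - e) + e \<in> G"
proof -
  obtain s t where st: "(s, t) \<in> Q" "z = F (s, t)" using assms by (auto simp: G_def)
  have "flow r (z - e) + e = F (r + s, t)"
    by (simp add: st F_def flow_diff flow_add add.assoc)
  then show ?thesis using st assms by (auto simp: G_def)
qed

lemma G_flow_upper:
  assumes "z \<in> G" "0 \<le> r"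
  shows "flow r (z - (e + w)) + (e + w) \<in> G"
proof -
  have "flow r (e + (e + w) - z - e) + e \<in> G"
    using G_flow_lower[OF G_symmetric] assms by blast
  from G_symmetric[OF this] show ?thesis
    by (simp add: flow_diff algebra_simps flow_lincomb(1)[symmetric])
qed

lemma q_pos: "0 < t \<Longrightarrow> 0 < q t"
  using neg le by (auto simp: q_def divide_simps)

lemma F_deriv: "(F has_derivative (\<lambda>h. fst h *\<^sub>R flow (fst p) (B *v w)
     - (fst h + snd h) *\<^sub>R flow (fst p + snd p) (B *v w))) (at p)"
proof -
  have f: "((\<lambda>t. flow t w) has_derivative (\<lambda>h. h *\<^sub>R flow t (B *v w))) (at t)" for t
    using flow_has_vector_derivative[of w t UNIV] by (simp add: has_vector_derivative_def)
  have "((\<lambda>p. flow (fst p) w) has_derivative (\<lambda>h. fst h *\<^sub>R flow (fst p) (B *v w))) (at p)"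
    by (rule has_derivative_compose[OF _ f]) (auto intro!: derivative_eq_intros)
  moreover have "((\<lambda>p. flow (fst p + snd p) w) has_derivative
      (\<lambda>h. (fst h + snd h) *\<^sub>R flow (fst p + snd p) (B *v w))) (at p)"
    by (rule has_derivative_compose[OF _ f]) (auto intro!: derivative_eq_intros)
  ultimately show ?thesis
    unfolding F_def by (auto intro!: derivative_eq_intros)
qed

text \<open>Up to sign this is the Jacobian of \<open>F\<close>. Applying \<open>flow (- s)\<close>
  multiplies the determinant by a constant and reduces to \<open>s = 0\<close>, where
  \<open>q t\<close> times the determinant of \<open>B *v w\<close> and \<open>B *v (B *v w)\<close>
  remains.\<close>

lemma cross_F_nonzero:
  assumes "0 < t"
  shows "cross (flow s (B *v w)) (flow (s + t) (B *v w)) \<noteq> 0"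
proof
  assume "cross (flow s (B *v w)) (flow (s + t) (B *v w)) = 0"
  then have "cross (flow (- s) (flow s (B *v w))) (flow (- s) (flow s (flow t (B *v w)))) = 0"
    by (simp only: flow_add cross_linear[OF linear_flow[of "- s"]])
  then have "q t * cross (B *v w) (B *v (B *v w)) = 0"
    by (simp add: flow_def[of t] cross_algebra)
  then show False using q_pos[OF assms] indep neg le by (auto simp: cross_matrix)
qed

lemma smooth_F: "smooth_on Q F"
proof -
  have Q: "open Q" by (simp add: open_Times)
  have "bounded_linear (\<lambda>p :: real \<times> real. fst p + snd p)"
    by (intro bounded_linear_add bounded_linear_fst bounded_linear_snd)
  then have "Ck_on n Q (\<lambda>p. e + flow (fst p) w + flow (fst p + snd p) (- w))" for n
    by (intro Ck_on_add Q Ck_on_const Ck_on_flow bounded_linear_fst)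
  then show ?thesis by (simp add: smooth_on_def F_def[abs_def] flow_lincomb)
qed

lemma smooth_inv_F: "open G" "smooth_on G (inv_into Q F)"
proof -
  have Q: "open Q" by (simp add: open_Times)
  let ?X = "\<lambda>p. flow (fst p) (B *v w)" and ?Y = "\<lambda>p. flow (fst p + snd p) (B *v w)"
  let ?D = "\<lambda>p. inverse (cross (?X p) (?Y p))"
  \<comment> \<open>Cramer's rule for \<open>z = a X - (a + b) Y\<close>: the two quotients are
    \<open>a\<close> and \<open>a + b\<close>, and the vectors \<open>(1, -1)\<close>,
    \<open>(0, 1)\<close> recombine them to \<open>(a, b)\<close>.\<close>
  let ?g = "\<lambda>p z. (cross z (?Y p) * ?D p) *\<^sub>R (1, -1) + (cross z (?X p) * ?D p) *\<^sub>R (0, 1 :: real) :: real \<times> real"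
  have lin: "bounded_linear (\<lambda>p :: real \<times> real. fst p + snd p)"
    by (intro bounded_linear_add bounded_linear_fst bounded_linear_snd)
  have nz: "cross (?X p) (?Y p) \<noteq> 0" if "p \<in> Q" for p
    using that cross_F_nonzero[of "snd p" "fst p"] by auto
  have 1: "bounded_linear (?g p)" for p
    by (intro bounded_linear_add bounded_linear_scaleR_const bounded_linear_mult_const
      bounded_bilinear.bounded_linear_left[OF bounded_bilinear_cross])
  have 2: "?g p (fst h *\<^sub>R ?X p - (fst h + snd h) *\<^sub>R ?Y p) = h" if "p \<in> Q" for p h
    using nz[OF that] cross_commute[of "?Y p" "?X p"]
    by (cases h) (auto simp: cross_algebra field_simps)
  have X: "Ck_on n Q ?X" and Y: "Ck_on n Q ?Y" for n
    using Q by (intro Ck_on_flow bounded_linear_fst lin, assumption)+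
  have C: "Ck_on n Q (\<lambda>p. cross (a p) (b p))" if "Ck_on n Q a" "Ck_on n Q b" for a b n
    by (rule Ck_on_bilinear[OF bounded_bilinear_cross Q that])
  have 3: "Ck_on n Q (\<lambda>p. ?g p z)" for n z
    by (intro Ck_on_add Q Ck_on_bilinear[OF bounded_bilinear_scaleR] Ck_on_bilinear[OF bounded_bilinear_mult]
        C Ck_on_inverse X Y Ck_on_const nz)
  show "open G" "smooth_on G (inv_into Q F)"
    using smooth_inv_into[OF Q inj_on_F _ F_deriv, of ?g] 1 2 3 unfolding G_def by auto
qed

lemma diffeomorphism_F: "diffeomorphism_onto_image F Q"
  using smooth_inv_F smooth_F inj_on_F
  by (simp add: diffeomorphism_onto_image_def G_def open_Times)

text \<open>The points \<open>F (s, 1)\<close> tend to \<open>e\<close> as \<open>s\<close> grows.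
  The comparison trajectories for recurrence start or end at this equilibrium.\<close>

lemma e_in_closure_G: "e \<in> closure G"
proof -
  have "((\<lambda>s. flow s (w - flow 1 w) + e) \<longlongrightarrow> 0 + e) at_top"
    by (intro tendsto_intros flow_tendsto_0)
  moreover have "\<forall>\<^sub>F s in at_top. flow s (w - flow 1 w) + e \<in> closure G"
  proof (rule eventually_mono[OF eventually_gt_at_top[of 0]])
    fix s :: real assume "0 < s"
    have "flow s (w - flow 1 w) + e = F (s, 1)" by (simp add: F_def flow_diff flow_add)
    then show "flow s (w - flow 1 w) + e \<in> closure G"
      using \<open>0 < s\<close> closure_subset[of G] by (auto simp: G_def)
  qed
  ultimately have "0 + e \<in> closure G"
    by (intro Lim_in_closed_set[OF closed_closure _ trivial_limit_at_top_linorder])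
  then show ?thesis by simp
qed

text \<open>For large \<open>T\<close> the starting point \<open>v\<close> only perturbs \<open>F\<close> slightly, so the equation is a
  fixed point problem near \<open>F\<inverse> z\<close>, solvable by Brouwer's theorem.\<close>

lemma exact_reach:
  assumes "z \<in> G"
  obtains s t T where "0 < s" "0 < t" "0 < T" "z = F (s, t) + flow (s + t + T) (v - e)"
proof -
  let ?g = "inv_into Q F"
  have Q: "open Q" by (simp add: open_Times)
  have gQ: "?g y \<in> Q" and Fg: "F (?g y) = y" if "y \<in> G" for y
    using that inv_into_into[of y F Q] f_inv_into_f[of y F Q] by (auto simp: G_def)
  have contg: "continuous_on G ?g"
    using smooth_inv_F(2) Ck_on.simps(1) unfolding smooth_on_def by blast
  obtain r where r: "0 < r" "cball (?g z) r \<subseteq> Q"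
    using Q[unfolded open_contains_cball, THEN bspec, OF gQ[OF assms]] by blast
  have "continuous (at z) ?g"
    using contg assms by (simp add: continuous_on_eq_continuous_at[OF smooth_inv_F(1)])
  \<comment> \<open>\<open>d1\<close> keeps the inverse within the ball, \<open>d2\<close> keeps the
    perturbed argument in \<open>G\<close>.\<close>
  then obtain d1 where d1: "0 < d1" "\<And>y. dist y z < d1 \<Longrightarrow> dist (?g y) (?g z) < r"
    using r(1) unfolding continuous_at_eps_delta by blast
  obtain d2 where d2: "0 < d2" "ball z d2 \<subseteq> G"
    using smooth_inv_F(1)[unfolded open_contains_ball, THEN bspec, OF assms] by blast
  have "\<forall>\<^sub>F \<tau> in at_top. norm (flow \<tau> (v - e)) < min d1 d2"
    using tendstoD[OF flow_tendsto_0, of "min d1 d2" "v - e"] d1 d2 by simp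
  then obtain T0 where T0: "\<And>\<tau>. T0 \<le> \<tau> \<Longrightarrow> norm (flow \<tau> (v - e)) < min d1 d2"
    by (auto simp: eventually_at_top_linorder)
  \<comment> \<open>The bound 1 makes \<open>T\<close> positive; as both components of
    \<open>p\<close> are positive on the ball, every total time is at least
    \<open>T0\<close>.\<close>
  define T where "T = max T0 1"
  let ?y = "\<lambda>p. z - flow (fst p + snd p + T) (v - e)"
  have y: "dist (?y p) z < min d1 d2" if "p \<in> cball (?g z) r" for p
    using that r(2) T0[of "fst p + snd p + T"] by (auto simp: T_def dist_norm)
  then have yG: "?y p \<in> G" if "p \<in> cball (?g z) r" for p
    using that d2(2) by (auto simp: subset_iff dist_commute)
  obtain p where p: "p \<in> cball (?g z) r" "?g (?y p) = p"
  proof (rule brouwer)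
    show "compact (cball (?g z) r)" "convex (cball (?g z) r)" "cball (?g z) r \<noteq> {}"
      using r by auto
    show "continuous_on (cball (?g z) r) (\<lambda>p. ?g (?y p))"
      by (rule continuous_on_compose2[OF contg]) (auto intro!: continuous_intros yG)
    show "(\<lambda>p. ?g (?y p)) \<in> cball (?g z) r \<rightarrow> cball (?g z) r"
      using d1(2)[OF less_le_trans[OF y min.cobounded1]]
      by (auto simp: dist_commute less_imp_le)
  qed (rule that)
  have "?y p = F p" using Fg[OF yG[OF p(1)]] p(2) by simp
  then have "z = F (fst p, snd p) + flow (fst p + snd p + T) (v - e)" by (simp add: algebra_simps)
  moreover have "p \<in> Q" using p r by blast
  ultimately show ?thesis using that[of "fst p" "snd p" T] by (auto simp: T_def)
qed

end

section \<open>Solutions of the control system\<close>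

lemma locally_finite_Un:
  "locally_finite_points S \<Longrightarrow> locally_finite_points T \<Longrightarrow> locally_finite_points (S \<union> T)"
  by (simp add: locally_finite_points_def Int_Un_distrib2)

lemma locally_finite_finite: "finite S \<Longrightarrow> locally_finite_points S"
  by (simp add: locally_finite_points_def)

lemma locally_finite_countable:
  assumes "locally_finite_points S"
  shows "countable S"
proof -
  have "S = (\<Union>n::nat. S \<inter> {- real n..real n})"
  proof -
    have "\<exists>n::nat. - real n \<le> x \<and> x \<le> real n" for x
      using real_arch_simple[of "\<bar>x\<bar>"] by (auto simp: abs_le_iff minus_le_iff)
    then show ?thesis by fastforce
  qed
  moreover have "countable (\<Union>n::nat. S \<inter> {- real n..real n})"
    using assms by (intro countable_UN) (auto simp: locally_finite_points_def intro: countable_finite)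
  ultimately show ?thesis by simp
qed

lemma locally_finite_continuous:
  assumes "locally_finite_points S" "\<And>a b. {a..b} \<inter> S = {} \<Longrightarrow> u constant_on {a..b}" "t \<notin> S"
  shows "isCont (u :: real \<Rightarrow> real) t"
proof -
  have "finite (S \<inter> {t-1..t+1})" using assms(1) by (simp add: locally_finite_points_def)
  from finite_set_avoid[OF this, of t]
  obtain d where d: "0 < d" "\<And>x. x \<in> S \<inter> {t-1..t+1} \<Longrightarrow> x \<noteq> t \<Longrightarrow> d \<le> dist t x" by blast
  define r where "r = min 1 (d / 2)"
  have r: "0 < r" "r \<le> 1" "r < d" using d by (auto simp: r_def)
  have "{t - r..t + r} \<inter> S = {}"
  proof -
    have False if "x \<in> S" "t - r \<le> x" "x \<le> t + r" for x
      using d(2)[of x] that r assms(3) by (force simp: dist_real_def)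
    then show ?thesis by fastforce
  qed
  from assms(2)[OF this] obtain c where c: "\<And>x. x \<in> {t - r..t + r} \<Longrightarrow> u x = c"
    unfolding constant_on_def by blast
  have "\<forall>\<^sub>F x in nhds t. c = u x"
    using eventually_nhds_in_open[of "{t - r<..<t + r}" t] r
    by (auto elim!: eventually_mono simp: c)
  moreover have "isCont (\<lambda>_. c) t" by simp
  ultimately show ?thesis using isCont_cong[of "\<lambda>_. c" u t] by simp
qed

lemma piecewise_constant_if:
  assumes "piecewise_constant u" "piecewise_constant u'"
  shows "piecewise_constant (\<lambda>t. if t < a then u t else u' t)"
proof -
  obtain S S' where S: "locally_finite_points S" "\<And>a b. {a..b} \<inter> S = {} \<Longrightarrow> u constant_on {a..b}"
    and S': "locally_finite_points S'" "\<And>a b. {a..b} \<inter> S' = {} \<Longrightarrow> u' constant_on {a..b}"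
    using assms unfolding piecewise_constant_def by metis
  have "(\<lambda>t. if t < a then u t else u' t) constant_on {p..q}"
    if pq: "{p..q} \<inter> (S \<union> S' \<union> {a}) = {}" for p q
  proof -
    have "u constant_on {p..q}" "u' constant_on {p..q}" using pq S(2) S'(2) by blast+
    moreover have "a \<notin> {p..q}" using pq by blast
    ultimately show ?thesis
      unfolding constant_on_def by (cases "a < p") (fastforce+)
  qed
  then show ?thesis
    unfolding piecewise_constant_def
    by (intro exI[of _ "S \<union> S' \<union> {a}"] conjI locally_finite_Un S(1) S'(1) locally_finite_finite) auto
qed

lemma piecewise_constant_const: "piecewise_constant (\<lambda>_. c)"
  unfolding piecewise_constant_def constant_on_def
  by (intro exI[of _ "{}"]) (auto simp: locally_finite_points_def)

lemma controls_const: "c \<in> \<Omega> \<Longrightarrow> (\<lambda>_. c) \<in> controls \<Omega>"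
  by (auto simp: controls_def piecewise_constant_const)

lemma controls_if: "u \<in> controls \<Omega> \<Longrightarrow> u' \<in> controls \<Omega> \<Longrightarrow> (\<lambda>t. if t < a then u t else u' t) \<in> controls \<Omega>"
  by (auto simp: controls_def piecewise_constant_if)

text \<open>\<open>\<epsilon>\<close> is the direction of time in which the system is asymptotically stable.\<close>

locale control_system = planar_flow +
  fixes A :: "real^2^2" and \<epsilon> :: real and \<zeta> :: "real^2" and um up :: real
  assumes A_eq: "A *v v = \<epsilon> *\<^sub>R (B *v v)" and eps: "\<epsilon> = 1 \<or> \<epsilon> = -1"
    and inv: "invertible A" and um_less_up: "um < up" and cross_\<zeta>: "cross \<zeta> (B *v \<zeta>) \<noteq> 0"
begin

abbreviation "\<Omega> \<equiv> {um..up}"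
abbreviation "eq \<equiv> equilibrium A \<zeta>"
abbreviation "\<phi> \<equiv> phi A \<zeta>"

lemma eps_sq [simp]: "\<epsilon> * \<epsilon> = 1" "\<epsilon> * (\<epsilon> * x) = x"
  using eps by auto

lemma A_eq_equilibrium: "A *v eq c = - (c *\<^sub>R \<zeta>)"
proof -
  have "A ** matrix_inv A = mat 1"
    using inv someI_ex[of "\<lambda>X. A ** X = mat 1 \<and> X ** A = mat 1"]
    unfolding invertible_def matrix_inv_def by blast
  then have *: "A *v (matrix_inv A *v \<zeta>) = \<zeta>"
    by (simp add: matrix_vector_mul_assoc)
  have eqc: "eq c = (- c) *\<^sub>R (matrix_inv A *v \<zeta>)" by (simp add: equilibrium_def)
  show ?thesis unfolding eqc matrix_vector_mult_scaleR * by simp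
qed

lemma eq_lincomb: "eq (u * c + v * d) = u *\<^sub>R eq c + v *\<^sub>R eq d" "eq 0 = 0"
  by (simp_all add: equilibrium_def algebra_simps)

text \<open>The deviation from the equilibrium, carried along the flow to time \<open>b\<close>, is
  continuous with zero derivative off a finite set, hence constant.\<close>

lemma constant_arc:
  assumes "a \<le> b" "continuous_on {a..b} x" "finite K"
    and deriv: "\<And>t. a < t \<Longrightarrow> t < b \<Longrightarrow> t \<notin> K \<Longrightarrow> (x has_vector_derivative A *v x t + c *\<^sub>R \<zeta>) (at t)"
  shows "x b = flow (\<epsilon> * (b - a)) (x a - eq c) + eq c"
proof -
  let ?y = "\<lambda>t. flow (\<epsilon> * (b - t)) (x t - eq c)"
  have "?y b = ?y a"
  proof (rule has_derivative_zero_unique_strong_interval[where k = "insert a (insert b K)"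
        and f = ?y and a = a and b = b and x = b and y = "?y a"])
    show "continuous_on {a..b} ?y" by (intro continuous_intros assms)
    show "(?y has_derivative (\<lambda>h. 0)) (at t within {a..b})"
      if t: "t \<in> {a..b} - insert a (insert b K)" for t
    proof -
      have *: "A *v x t + c *\<^sub>R \<zeta> = \<epsilon> *\<^sub>R (B *v (x t - eq c))"
        unfolding A_eq[symmetric] by (simp add: matrix_vector_mult_diff_distrib A_eq_equilibrium)
      have "(x has_vector_derivative A *v x t + c *\<^sub>R \<zeta>) (at t)"
        using deriv[of t] t by auto
      then have "((\<lambda>t. x t - eq c) has_vector_derivative \<epsilon> *\<^sub>R (B *v (x t - eq c))) (at t)"
        unfolding * by (simp add: has_vector_derivative_diff_const)
      moreover have "((\<lambda>t. \<epsilon> * (b - t)) has_real_derivative - \<epsilon>) (at t)"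
        by (auto intro!: derivative_eq_intros)
      ultimately have "(?y has_vector_derivative 0) (at t)"
        by (rule has_vector_derivative_eq_rhs[OF flow_deriv]) (simp add: flow_lincomb)
      then show ?thesis
        by (auto simp: has_vector_derivative_def intro: has_derivative_at_withinI)
    qed
  qed (use assms in auto)
  then show ?thesis by simp (metis add_diff_cancel_right' add.commute diff_add_cancel)
qed

text \<open>The difference obeys the homogeneous equation, which is \<open>constant_arc\<close> with
  \<open>c = 0\<close> and \<open>eq 0 = 0\<close>. Uniqueness of solutions and synchronization of
  trajectories both come from here.\<close>

lemma solutions_diff:
  assumes "is_solution A \<zeta> v u x" "is_solution A \<zeta> v' u x'"
  shows "x t - x' t = flow (\<epsilon> * t) (v - v')"
proof -
  let ?z = "\<lambda>t. x t - x' t"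
  obtain S S' where S: "locally_finite_points S" "\<And>s. s \<notin> S \<Longrightarrow> (x has_vector_derivative A *v x s + u s *\<^sub>R \<zeta>) (at s)"
    and S': "locally_finite_points S'" "\<And>s. s \<notin> S' \<Longrightarrow> (x' has_vector_derivative A *v x' s + u s *\<^sub>R \<zeta>) (at s)"
    using assms unfolding is_solution_def by blast
  have "?z b = flow (\<epsilon> * (b - a)) (?z a - eq 0) + eq 0" if "a \<le> b" for a b
  proof (rule constant_arc[where K = "(S \<union> S') \<inter> {a..b}"])
    show "continuous_on {a..b} ?z"
      using assms continuous_on_subset[of UNIV] unfolding is_solution_def
      by (auto intro!: continuous_intros)
    show "finite ((S \<union> S') \<inter> {a..b})"
      using locally_finite_Un[OF S(1) S'(1)] by (simp add: locally_finite_points_def)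
    show "(?z has_vector_derivative A *v ?z s + 0 *\<^sub>R \<zeta>) (at s)"
      if "a < s" "s < b" "s \<notin> (S \<union> S') \<inter> {a..b}" for s
      using has_vector_derivative_diff[OF S(2)[of s] S'(2)[of s]] that
      by (simp add: matrix_vector_mult_diff_distrib)
  qed fact
  then have *: "?z b = flow (\<epsilon> * (b - a)) (?z a)" if "a \<le> b" for a b
    using that by (simp add: eq_lincomb)
  have z0: "?z 0 = v - v'" using assms by (simp add: is_solution_def)
  show ?thesis
  proof (cases "0 \<le> t")
    case True
    then show ?thesis using *[of 0 t] z0 by simp
  next
    case False
    then have "v - v' = flow (- (\<epsilon> * t)) (?z t)" using *[of t 0] z0 by simp
    then show ?thesis by simp
  qed
qed

text \<open>Variation of constants, with \<open>u\<close> times the backward flow of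
  \<open>\<zeta>\<close> as integrand. It is integrable because the control is bounded and
  continuous off a countable set.\<close>

lemma solution_exists:
  assumes "u \<in> controls \<Omega>"
  shows "\<exists>x. is_solution A \<zeta> v u x"
proof -
  obtain S where S: "locally_finite_points S" "\<And>a b. {a..b} \<inter> S = {} \<Longrightarrow> u constant_on {a..b}"
    using assms unfolding controls_def piecewise_constant_def by blast
  have bound: "\<bar>u t\<bar> \<le> \<bar>um\<bar> + \<bar>up\<bar>" for t
  proof -
    have "u t \<in> \<Omega>" using assms unfolding controls_def by blast
    then show ?thesis by auto
  qed
  let ?g = "\<lambda>t. u t *\<^sub>R flow (- (\<epsilon> * t)) \<zeta>"
  have cu: "isCont u t" if "t \<notin> S" for t using locally_finite_continuous[OF S that] .
  have cf: "continuous_on X (\<lambda>t. flow (- (\<epsilon> * t)) \<zeta>)" for X by (intro continuous_intros)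
  have cg: "isCont ?g t" if "t \<notin> S" for t
    using cu[OF that] cf[of UNIV] by (intro continuous_intros) (auto simp: continuous_on_eq_continuous_at)
  have int: "?g integrable_on {a..b}" for a b
  proof (rule measurable_bounded_by_integrable_imp_integrable)
    have "?g \<in> borel_measurable borel"
      using cg by (intro borel_measurable_continuous_countable_exceptions[OF locally_finite_countable[OF S(1)]]
         continuous_at_imp_continuous_on) auto
    then show "?g \<in> borel_measurable (lebesgue_on {a..b})"
      by (intro measurable_restrict_space1 measurable_completion) simp
    show "(\<lambda>t. (\<bar>um\<bar> + \<bar>up\<bar>) * norm (flow (- (\<epsilon> * t)) \<zeta>)) integrable_on {a..b}"
      by (intro integrable_continuous_real continuous_intros)
  qed (auto intro: mult_right_mono[OF bound])
  \<comment> \<open>A signed integral from 0 to \<open>t\<close>: a term with reversed limits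
    vanishes. The identity \<open>I\<close> moves the base point to \<open>-N\<close>, which gives
    two-sided derivatives at every \<open>t\<close> outside \<open>S\<close>.\<close>
  let ?I = "\<lambda>t. integral {0..t} ?g - integral {t..0} ?g"
  have I: "?I t = integral {-N..t} ?g - integral {-N..0} ?g" if "t \<in> {-N..N}" for t N
  proof (cases "0 \<le> t")
    case True
    then have "integral {t..0} ?g = 0" by (cases "t = 0") auto
    then show ?thesis
      using Henstock_Kurzweil_Integration.integral_combine[of "-N" 0 t ?g] that True int by (simp add: algebra_simps)
  next
    case False
    then show ?thesis
      using Henstock_Kurzweil_Integration.integral_combine[of "-N" t 0 ?g] that int by (simp add: algebra_simps)
  qed
  have contI: "isCont ?I t" for t
  proof -
    define N where "N = \<bar>t\<bar> + 1"
    have "continuous_on {-N..N} (\<lambda>t. integral {-N..t} ?g - integral {-N..0} ?g)"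
      by (intro continuous_intros indefinite_integral_continuous_1 int)
    then have "continuous_on {-N..N} ?I" by (rule continuous_on_eq) (simp add: I[of _ N])
    moreover have "t \<in> interior {-N..N}" by (auto simp: N_def)
    ultimately show ?thesis by (rule continuous_on_interior)
  qed
  have derivI: "(?I has_vector_derivative ?g t) (at t)" if "t \<notin> S" for t
  proof -
    define N where "N = \<bar>t\<bar> + 1"
    have t: "t \<in> {-N<..<N}" by (auto simp: N_def)
    have "((\<lambda>t. integral {-N..t} ?g) has_vector_derivative ?g t) (at t within {-N..N} - {})"
      using t by (intro integral_has_vector_derivative_continuous_at[OF int _ _
            continuous_at_imp_continuous_at_within[OF cg[OF that]]]) simp_all
    moreover have "at t within {-N..N} = at t"
      by (rule at_within_interior) (use t in auto)
    ultimately have "((\<lambda>t. integral {-N..t} ?g) has_vector_derivative ?g t) (at t)" by simp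
    from has_vector_derivative_diff[OF this has_vector_derivative_const[of "integral {-N..0} ?g"]]
    have "((\<lambda>t. integral {-N..t} ?g - integral {-N..0} ?g) has_vector_derivative ?g t) (at t)" by simp
    then show ?thesis
      by (rule has_vector_derivative_transform_within_open[where S = "{-N<..<N}"]) (use t in \<open>auto simp: I[of _ N]\<close>)
  qed
  have "is_solution A \<zeta> v u (\<lambda>t. flow (\<epsilon> * t) (v + ?I t))"
    unfolding is_solution_def
  proof (intro conjI exI allI impI)
    show "continuous_on UNIV (\<lambda>t. flow (\<epsilon> * t) (v + ?I t))"
      using contI by (intro continuous_flow continuous_on_add continuous_on_mult continuous_on_const continuous_on_id)
        (simp add: continuous_at_imp_continuous_on)
    fix s assume "s \<notin> S"
    have "((\<lambda>t. v + ?I t) has_vector_derivative ?g s) (at s)"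
      using derivI[OF \<open>s \<notin> S\<close>] by (rule has_vector_derivative_eq_rhs[OF has_vector_derivative_add[OF has_vector_derivative_const]]) simp
    moreover have "((\<lambda>t. \<epsilon> * t) has_real_derivative \<epsilon>) (at s)" by (auto intro!: derivative_eq_intros)
    ultimately show "((\<lambda>t. flow (\<epsilon> * t) (v + ?I t)) has_vector_derivative
        A *v flow (\<epsilon> * s) (v + ?I s) + u s *\<^sub>R \<zeta>) (at s)"
      by (rule has_vector_derivative_eq_rhs[OF flow_deriv])
        (simp add: A_eq matrix_flow flow_lincomb(2))
  qed (auto intro: S)
  then show ?thesis by blast
qed

lemma phi_solution: "u \<in> controls \<Omega> \<Longrightarrow> is_solution A \<zeta> v u (\<lambda>t. \<phi> t v u)"
proof -
  assume "u \<in> controls \<Omega>"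
  then obtain x where x: "is_solution A \<zeta> v u x" using solution_exists by blast
  have "y = x" if "is_solution A \<zeta> v u y" for y
    using solutions_diff[OF that x] by (simp add: fun_eq_iff flow_lincomb)
  then have "(THE x. is_solution A \<zeta> v u x) = x" using x by blast
  then show ?thesis using x by (simp add: phi_def)
qed

lemma phi_diff: "u \<in> controls \<Omega> \<Longrightarrow> \<phi> t v u - \<phi> t v' u = flow (\<epsilon> * t) (v - v')"
  using solutions_diff phi_solution by blast

lemma phi_0: "u \<in> controls \<Omega> \<Longrightarrow> \<phi> 0 v u = v"
  using phi_solution by (auto simp: is_solution_def)

definition arc :: "real \<Rightarrow> real \<Rightarrow> real^2 \<Rightarrow> real^2" where
  "arc c t v = flow (\<epsilon> * t) (v - eq c) + eq c"

lemma arc_add: "arc c s (arc c t v) = arc c (s + t) v" "arc c 0 v = v"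
  by (simp_all add: arc_def flow_add[symmetric] algebra_simps)

text \<open>The control is prescribed on the open interval because its values at breakpoints are
  arbitrary. The second equation runs the arc backward in time.\<close>

lemma phi_arc:
  assumes u: "u \<in> controls \<Omega>" and c: "\<And>t. a < t \<Longrightarrow> t < b \<Longrightarrow> u t = c" and "a \<le> b"
  shows "\<phi> b v u = arc c (b - a) (\<phi> a v u)" "\<phi> a v u = arc c (a - b) (\<phi> b v u)"
proof -
  obtain S where S: "locally_finite_points S"
    "\<And>s. s \<notin> S \<Longrightarrow> ((\<lambda>t. \<phi> t v u) has_vector_derivative A *v \<phi> s v u + u s *\<^sub>R \<zeta>) (at s)"
    using phi_solution[OF u] unfolding is_solution_def by blast
  show *: "\<phi> b v u = arc c (b - a) (\<phi> a v u)"
    unfolding arc_def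
  proof (rule constant_arc[where K = "S \<inter> {a..b}"])
    show "continuous_on {a..b} (\<lambda>t. \<phi> t v u)"
      using phi_solution[OF u] continuous_on_subset unfolding is_solution_def by blast
    show "finite (S \<inter> {a..b})" using S(1) by (simp add: locally_finite_points_def)
    show "((\<lambda>t. \<phi> t v u) has_vector_derivative A *v \<phi> s v u + c *\<^sub>R \<zeta>) (at s)"
      if "a < s" "s < b" "s \<notin> S \<inter> {a..b}" for s
      using S(2)[of s] c[of s] that by auto
  qed fact
  show "\<phi> a v u = arc c (a - b) (\<phi> b v u)" unfolding * arc_add by (simp add: arc_add)
qed

lemma phi_const: "c \<in> \<Omega> \<Longrightarrow> \<phi> t v (\<lambda>_. c) = arc c t v"
  using phi_arc[of "\<lambda>_. c" 0 t c v] phi_arc[of "\<lambda>_. c" t 0 c v] controls_const[of c \<Omega>]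
  by (cases "0 \<le> t") (simp_all add: phi_0)

text \<open>\<open>arc\<close> is affine in the control value, so a convex set invariant under both extreme constant
  controls is invariant under every admissible constant control.\<close>

lemma convex_invariant_arc:
  assumes "convex K"
    and um: "\<And>z t. z \<in> K \<Longrightarrow> 0 \<le> t \<Longrightarrow> arc um (\<epsilon> * t) z \<in> K"
    and up: "\<And>z t. z \<in> K \<Longrightarrow> 0 \<le> t \<Longrightarrow> arc up (\<epsilon> * t) z \<in> K"
    and "c \<in> \<Omega>" "z \<in> K" "0 \<le> \<epsilon> * t"
  shows "arc c t z \<in> K"
proof -
  define l where "l = (c - um) / (up - um)"
  have "l * (up - um) = c - um" using um_less_up by (simp add: l_def)
  then have "c = (1 - l) * um + l * up" by (simp add: algebra_simps)
  moreover have "0 \<le> l" "l \<le> 1" using assms(4) um_less_up by (simp_all add: l_def)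
  ultimately have l: "0 \<le> l" "l \<le> 1" "c = (1 - l) * um + l * up" by auto
  have "arc c t z = (1 - l) *\<^sub>R arc um t z + l *\<^sub>R arc up t z"
    unfolding arc_def l(3) eq_lincomb by (simp add: flow_diff flow_lincomb(1,2)[symmetric] algebra_simps)
  moreover have "arc um t z \<in> K" "arc up t z \<in> K"
    using um[OF assms(5,6)] up[OF assms(5,6)] by simp_all
  ultimately show ?thesis using assms(1) l by (simp add: convexD)
qed

text \<open>Induction on the number of breakpoints strictly between \<open>a\<close> and
  \<open>b\<close>: with none the trajectory is one \<open>arc\<close>, and splitting at a
  breakpoint removes it from both open intervals. For \<open>\<epsilon> = -1\<close> time runs down
  from \<open>a\<close> to \<open>b\<close>.\<close>

lemma invariant_phi:
  assumes K_inv: "\<And>c z t. c \<in> \<Omega> \<Longrightarrow> z \<in> K \<Longrightarrow> 0 \<le> \<epsilon> * t \<Longrightarrow> arc c t z \<in> K"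
    and u: "u \<in> controls \<Omega>" and "0 \<le> \<epsilon> * (b - a)" "\<phi> a v u \<in> K"
  shows "\<phi> b v u \<in> K"
proof -
  obtain S where S: "locally_finite_points S" "\<And>a b. {a..b} \<inter> S = {} \<Longrightarrow> u constant_on {a..b}"
    using u unfolding controls_def piecewise_constant_def by blast
  have fin: "finite (S \<inter> {min a b<..<max a b})" for a b
    by (rule finite_subset[of _ "S \<inter> {min a b..max a b}"])
      (use S(1) in \<open>auto simp: locally_finite_points_def\<close>)
  have "\<phi> a v u \<in> K \<Longrightarrow> 0 \<le> \<epsilon> * (b - a) \<Longrightarrow> \<phi> b v u \<in> K"
  proof (induction "card (S \<inter> {min a b<..<max a b})" arbitrary: a b rule: less_induct)
    case less
    show ?case
    proof (cases "S \<inter> {min a b<..<max a b} = {}")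
      case True
      define p where "p = (a + b) / 2"
      have c: "u t = u p" if "min a b < t" "t < max a b" for t
      proof -
        have "min a b < p" "p < max a b" using that by (auto simp: p_def)
        then have "{min t p..max t p} \<subseteq> {min a b<..<max a b}" using that by auto
        then have "{min t p..max t p} \<inter> S = {}" using True by blast
        from S(2)[OF this] obtain k where "\<And>r. r \<in> {min t p..max t p} \<Longrightarrow> u r = k"
          unfolding constant_on_def by blast
        then show ?thesis by simp
      qed
      have "u p \<in> \<Omega>" using u unfolding controls_def by blast
      have "\<phi> b v u = arc (u p) (b - a) (\<phi> a v u)"
      proof (cases "a \<le> b")
        case True
        then show ?thesis using c by (intro phi_arc(1)[OF u]) simp_all
      next
        case False
        then show ?thesis using c by (intro phi_arc(2)[OF u]) simp_all
      qed
      then show ?thesis using K_inv[OF \<open>u p \<in> \<Omega>\<close> less.prems] by simp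
    next
      case False
      then obtain p where p: "p \<in> S" "min a b < p" "p < max a b" by auto
      have "0 \<le> \<epsilon> * (p - a)" "0 \<le> \<epsilon> * (b - p)"
        using p less.prems(2) eps by (auto simp: min_def max_def split: if_splits)
      moreover have "S \<inter> {min a p<..<max a p} \<subset> S \<inter> {min a b<..<max a b}"
        "S \<inter> {min p b<..<max p b} \<subset> S \<inter> {min a b<..<max a b}"
        using p by (auto simp: min_def max_def split: if_splits)
      ultimately show ?thesis
        using less.hyps[OF psubset_card_mono[OF fin]] less.prems(1) by blast
    qed
  qed
  then show ?thesis using assms by blast
qed

end

section \<open>The control set\<close>

context control_system
begin

text \<open>\<open>A\<close> maps the difference of the equilibria to a nonzero multiple of
  \<open>\<zeta>\<close>, so \<open>cross_\<zeta>\<close> makes its images under \<open>B\<close>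
  and \<open>B\<close> squared independent; \<open>cross_matrix\<close> carries this back.\<close>

sublocale switching B \<mu>1 \<mu>2 "eq up - eq um" "eq um"
proof
  let ?w = "eq up - eq um"
  have "\<epsilon> *\<^sub>R (B *v ?w) = (um - up) *\<^sub>R \<zeta>"
    unfolding A_eq[symmetric] by (simp add: matrix_vector_mult_diff_distrib A_eq_equilibrium algebra_simps)
  then have "\<epsilon> *\<^sub>R \<epsilon> *\<^sub>R (B *v ?w) = (\<epsilon> * (um - up)) *\<^sub>R \<zeta>" by simp
  then have Bw: "B *v ?w = (\<epsilon> * (um - up)) *\<^sub>R \<zeta>" by simp
  have "cross (B *v ?w) (B *v (B *v ?w)) \<noteq> 0"
    using cross_\<zeta> um_less_up eps unfolding Bw matrix_vector_mult_scaleR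
    by (auto simp: cross_algebra)
  then show "cross ?w (B *v ?w) \<noteq> 0"
    unfolding cross_matrix by simp
qed

lemma F_arc: "F (s, t) = arc um (\<epsilon> * s) (arc up (\<epsilon> * t) (eq um))"
  unfolding arc_def eps_sq by (simp add: F_def flow_diff flow_add flow_lincomb(1)[symmetric] algebra_simps)

lemma invariant_G:
  assumes "c \<in> \<Omega>" "z \<in> G" "0 \<le> \<epsilon> * t"
  shows "arc c t z \<in> G"
  using convex_G _ _ assms
proof (rule convex_invariant_arc)
  fix z and t :: real
  assume "z \<in> G" "0 \<le> t"
  then show "arc um (\<epsilon> * t) z \<in> G" "arc up (\<epsilon> * t) z \<in> G"
    using G_flow_lower[of z t] G_flow_upper[of z t] by (simp_all add: arc_def)
qed

lemma invariant_closure_G: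
  assumes "c \<in> \<Omega>" "z \<in> closure G" "0 \<le> \<epsilon> * t"
  shows "arc c t z \<in> closure G"
proof -
  have "continuous_on (closure G) (arc c t)"
    unfolding arc_def by (intro continuous_intros)
  then have "arc c t ` closure G \<subseteq> closure (arc c t ` G)"
    by (rule image_closure_subset) (auto intro: closure_subset[THEN subsetD])
  also have "\<dots> \<subseteq> closure G"
    by (intro closure_mono) (use invariant_G assms in blast)
  finally show ?thesis using assms by blast
qed

lemma phi_G: "u \<in> controls \<Omega> \<Longrightarrow> 0 \<le> \<epsilon> * (b - a) \<Longrightarrow> \<phi> a v u \<in> G \<Longrightarrow> \<phi> b v u \<in> G"
  by (rule invariant_phi[where K = G]) (rule invariant_G)

lemma phi_closure_G:
  "u \<in> controls \<Omega> \<Longrightarrow> 0 \<le> \<epsilon> * (b - a) \<Longrightarrow> \<phi> a v u \<in> closure G \<Longrightarrow> \<phi> b v u \<in> closure G"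
  by (rule invariant_phi[where K = "closure G"]) (rule invariant_closure_G)

text \<open>Convexity of the open set \<open>G\<close> excludes slits and punctures that the closure
  would fill.\<close>

lemma interior_closure_G: "interior (closure G) = G"
  using convex_interior_closure[OF convex_G] smooth_inv_F(1) by (simp add: interior_open)

lemma G_nonempty: "G \<noteq> {}"
  by (auto simp: G_def)

section \<open>Bang-bang controls and exact reachability\<close>

definition bang :: "real \<Rightarrow> real \<Rightarrow> real \<Rightarrow> real \<Rightarrow> real \<Rightarrow> real" where
  "bang a b d c = (\<lambda>t. if t < a then um else if t < b then up else if t < d then um else c)"

lemma bang_controls: "c \<in> \<Omega> \<Longrightarrow> bang a b d c \<in> controls \<Omega>"
  unfolding bang_def using um_less_up by (intro controls_if controls_const) auto

lemma phi_bang: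
  assumes "c \<in> \<Omega>" "0 < r1" "0 < r2" "0 < r3"
  defines "u \<equiv> bang r1 (r1 + r2) (r1 + r2 + r3) c"
  shows "\<phi> (r1 + r2 + r3) v u = arc um r3 (arc up r2 (arc um r1 v))"
    and "r1 + r2 + r3 \<le> t \<Longrightarrow> \<phi> t v u = arc c (t - (r1 + r2 + r3)) (\<phi> (r1 + r2 + r3) v u)"
proof -
  have u: "u \<in> controls \<Omega>" unfolding u_def by (intro bang_controls assms)
  have "\<phi> r1 v u = arc um (r1 - 0) (\<phi> 0 v u)"
    by (rule phi_arc[OF u]) (use assms in \<open>auto simp: bang_def\<close>)
  moreover have "\<phi> (r1 + r2) v u = arc up (r1 + r2 - r1) (\<phi> r1 v u)"
    by (rule phi_arc[OF u]) (use assms in \<open>auto simp: bang_def\<close>)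
  moreover have "\<phi> (r1 + r2 + r3) v u = arc um (r1 + r2 + r3 - (r1 + r2)) (\<phi> (r1 + r2) v u)"
    by (rule phi_arc[OF u]) (use assms in \<open>auto simp: bang_def\<close>)
  ultimately show "\<phi> (r1 + r2 + r3) v u = arc um r3 (arc up r2 (arc um r1 v))"
    by (simp add: phi_0[OF u])
  show "r1 + r2 + r3 \<le> t \<Longrightarrow> \<phi> t v u = arc c (t - (r1 + r2 + r3)) (\<phi> (r1 + r2 + r3) v u)"
    by (rule phi_arc[OF u]) (use assms in \<open>auto simp: bang_def\<close>)
qed

text \<open>The first \<open>um\<close> arc fixes \<open>eq um\<close>, so starting at
  \<open>v\<close> instead changes the endpoint \<open>F (s, t)\<close> exactly by the flowed
  deviation in \<open>exact_reach\<close>.\<close>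

lemma exact_reach_arc:
  assumes "z \<in> G"
  obtains s t T where "0 < s" "0 < t" "0 < T"
    "z = arc um (\<epsilon> * s) (arc up (\<epsilon> * t) (arc um (\<epsilon> * T) v))"
proof -
  obtain s t T where st: "0 < s" "0 < t" "0 < T" "z = F (s, t) + flow (s + t + T) (v - eq um)"
    using exact_reach[OF assms] by blast
  have "z = arc um (\<epsilon> * s) (arc up (\<epsilon> * t) (arc um (\<epsilon> * T) v))"
    unfolding st(4) F_arc arc_def eps_sq flow_add
    by (simp add: flow_diff flow_lincomb(1)[symmetric] algebra_simps)
  then show ?thesis using st that by blast
qed

lemma G_subset_orbit_stable:
  assumes "\<epsilon> = 1"
  shows "G \<subseteq> positive_orbit A \<zeta> \<Omega> v"
proof
  fix z assume "z \<in> G"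
  then obtain s t T where st: "0 < s" "0 < t" "0 < T"
    "z = arc um (\<epsilon> * s) (arc up (\<epsilon> * t) (arc um (\<epsilon> * T) v))"
    using exact_reach_arc by blast
  have um: "um \<in> \<Omega>" using um_less_up by simp
  have e: "\<epsilon> * x = x" for x using assms by simp
  \<comment> \<open>The innermost arc acts first, hence the durations in the order \<open>T\<close>,
    \<open>t\<close>, \<open>s\<close>.\<close>
  have "z = \<phi> (T + t + s) v (bang T (T + t) (T + t + s) um)"
    unfolding phi_bang(1)[OF um st(3,2,1)] using st(4) unfolding e .
  moreover have "0 \<le> T + t + s" using st by simp
  ultimately show "z \<in> positive_orbit A \<zeta> \<Omega> v"
    using bang_controls[OF um] unfolding positive_orbit_def by blast
qed

text \<open>For \<open>\<epsilon> = -1\<close> the formula in \<open>exact_reach_arc\<close> leads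
  backward in time from \<open>v\<close> to \<open>z\<close>; undoing its arcs, now with durations
  \<open>s\<close>, \<open>t\<close>, \<open>T\<close>, steers \<open>z\<close> forward to
  \<open>v\<close>.\<close>

lemma steer_unstable:
  assumes "\<epsilon> = -1" "z \<in> G" "c \<in> \<Omega>"
  obtains d u where "0 \<le> d" "u \<in> controls \<Omega>" "\<phi> d z u = v"
    "\<And>t. d \<le> t \<Longrightarrow> \<phi> t z u = arc c (t - d) v"
proof -
  obtain s t T where st: "0 < s" "0 < t" "0 < T"
    "z = arc um (\<epsilon> * s) (arc up (\<epsilon> * t) (arc um (\<epsilon> * T) v))"
    using exact_reach_arc[OF assms(2)] by blast
  let ?u = "bang s (s + t) (s + t + T) c"
  have e: "\<epsilon> * x = - x" for x using assms(1) by simp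
  have 1: "\<phi> (s + t + T) z ?u = v"
    unfolding phi_bang(1)[OF assms(3) st(1-3)] st(4) e by (simp add: arc_add)
  show ?thesis
  proof (rule that[of "s + t + T" ?u])
    show "\<phi> r z ?u = arc c (r - (s + t + T)) v" if "s + t + T \<le> r" for r
      using phi_bang(2)[OF assms(3) st(1-3) that, of z] 1 by simp
  qed (use st 1 bang_controls assms in auto)
qed

lemma G_subset_orbit_unstable:
  assumes "\<epsilon> = -1" "v \<in> G"
  shows "x \<in> positive_orbit A \<zeta> \<Omega> v"
proof -
  have "um \<in> \<Omega>" using um_less_up by simp
  from steer_unstable[OF assms this, of x] show ?thesis
    unfolding positive_orbit_def by (smt (verit) mem_Collect_eq)
qed

text \<open>A point of \<open>D\<close> is nearly revisited after arbitrarily long times, when the trajectory has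
  synchronized with one in \<open>closure G\<close>. In the unstable case the trajectories are followed
  backwards from a return near \<open>v\<close>.\<close>

lemma recurrent_subset:
  assumes "controlled_invariant A \<zeta> \<Omega> D" "approx_controllable A \<zeta> \<Omega> D"
  shows "D \<subseteq> closure G"
proof
  fix v assume v: "v \<in> D"
  obtain u where u: "u \<in> controls \<Omega>" "\<And>t. 0 \<le> t \<Longrightarrow> \<phi> t v u \<in> D"
    using assms(1) v unfolding controlled_invariant_def by blast
  have return: "\<exists>t' u'. 0 \<le> t' \<and> u' \<in> controls \<Omega> \<and> dist (\<phi> t' (\<phi> t v u) u') v < r"
    if "0 \<le> t" "0 < r" for t r
  proof -
    have "v \<in> closure (positive_orbit A \<zeta> \<Omega> (\<phi> t v u))"
      using assms(2) u(2)[OF that(1)] v unfolding approx_controllable_def by blast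
    then show ?thesis
      using that(2) unfolding closure_approachable positive_orbit_def by blast
  qed
  obtain \<kappa> where \<kappa>: "(\<kappa> \<longlongrightarrow> 0) at_top" "\<And>t v. norm (flow t v) \<le> \<kappa> t * norm v"
    using flow_bound by blast
  have "\<exists>k\<in>closure G. dist k v < r" if "0 < r" for r
  proof -
    \<comment> \<open>One bound for both cases: the deviation from \<open>eq um\<close> is taken at
      \<open>v\<close> itself in the stable case, at a return point within distance 1 of
      \<open>v\<close> in the unstable one.\<close>
    define R where "R = norm (v - eq um) + 1"
    have R: "0 < R" unfolding R_def by (simp add: add_nonneg_pos)
    have "\<forall>\<^sub>F t in at_top. \<kappa> t < r / (2 * R)"
      using \<kappa>(1) R that by (intro order_tendstoD(2)) auto
    then obtain T0 where T0: "\<And>t. T0 \<le> t \<Longrightarrow> \<kappa> t < r / (2 * R)"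
      by (auto simp: eventually_at_top_linorder)
    define T where "T = max T0 0"
    have T: "0 \<le> T" by (simp add: T_def)
    have small: "norm (flow t y) < r / 2" if "T \<le> t" "norm y \<le> R" for t y
    proof (cases "y = 0")
      case False
      have "norm (flow t y) \<le> \<kappa> t * norm y" by (rule \<kappa>)
      also have "\<dots> < r / (2 * R) * norm y"
        using T0[of t] that False by (intro mult_strict_right_mono) (auto simp: T_def)
      also have "\<dots> \<le> r / (2 * R) * R"
        using that R \<open>0 < r\<close> by (intro mult_left_mono) auto
      finally show ?thesis using R by simp
    qed (use \<open>0 < r\<close> in \<open>simp add: flow_lincomb\<close>)
    let ?vT = "\<phi> T v u"
    show ?thesis
    proof (cases "\<epsilon> = 1")
      case True
      then have e: "\<epsilon> * x = x" for x by simp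
      obtain t' u' where t': "0 \<le> t'" "u' \<in> controls \<Omega>" "dist (\<phi> t' ?vT u') v < r / 2"
        using return[OF T, of "r / 2"] \<open>0 < r\<close> by auto
      let ?kT = "\<phi> T (eq um) u" let ?k = "\<phi> t' ?kT u'"
      have "?kT \<in> closure G"
        by (rule phi_closure_G[OF u(1), of T 0]) (use True T e_in_closure_G phi_0[OF u(1)] in auto)
      then have "?k \<in> closure G"
        by (intro phi_closure_G[OF t'(2), of t' 0]) (use True t' phi_0[OF t'(2)] in auto)
      moreover have "\<phi> t' ?vT u' - ?k = flow (t' + T) (v - eq um)"
        by (simp add: e phi_diff u t' flow_add)
      then have "norm (\<phi> t' ?vT u' - ?k) < r / 2"
        using small[of "t' + T" "v - eq um"] t' by (simp add: R_def)
      then have "dist ?k v < r"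
        using t'(3) by (metis dist_commute dist_norm dist_triangle_half_r)
      ultimately show ?thesis by blast
    next
      case False
      then have e: "\<epsilon> * x = - x" for x using eps by auto
      obtain t' u' where t': "0 \<le> t'" "u' \<in> controls \<Omega>" "dist (\<phi> t' ?vT u') v < 1"
        using return[OF T, of 1] by auto
      let ?z = "\<phi> t' ?vT u'"
      \<comment> \<open>\<open>p\<close> is the point that \<open>u'\<close> carries to
        \<open>eq um\<close> in time \<open>t'\<close>; below, \<open>k\<close> is carried by
        \<open>u\<close> to \<open>p\<close> in time \<open>T\<close>. Backward invariance puts both
        in the closure of \<open>G\<close>.\<close>
      define p where "p = ?vT - flow t' (?z - eq um)"
      have "?z - \<phi> t' p u' = ?z - eq um"
        by (simp add: phi_diff t' p_def e)
      then have "\<phi> t' p u' \<in> closure G" using e_in_closure_G by simp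
      then have "\<phi> 0 p u' \<in> closure G"
        by (intro phi_closure_G[OF t'(2), of 0 t']) (use e t' in auto)
      then have p: "p \<in> closure G" by (simp add: phi_0 t')
      define k where "k = v - flow T (?vT - p)"
      have "?vT - \<phi> T k u = ?vT - p"
        by (simp add: phi_diff u k_def e)
      then have "\<phi> T k u \<in> closure G" using p by simp
      then have "\<phi> 0 k u \<in> closure G"
        by (intro phi_closure_G[OF u(1), of 0 T]) (use e T in auto)
      then have "k \<in> closure G" by (simp add: phi_0 u)
      moreover have "v - k = flow (T + t') (?z - eq um)"
        by (simp add: k_def p_def flow_add)
      moreover have "norm (?z - eq um) \<le> R"
      proof -
        have "norm (?z - eq um) \<le> norm (?z - v) + norm (v - eq um)"
          using norm_triangle_ineq[of "?z - v" "v - eq um"] by simp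
        then show ?thesis using t'(3) by (simp add: R_def dist_norm)
      qed
      then have "norm (flow (T + t') (?z - eq um)) < r / 2" using t' by (intro small) auto
      ultimately have "norm (v - k) < r" using \<open>0 < r\<close> by simp
      then show ?thesis using \<open>k \<in> closure G\<close> by (auto simp: dist_norm norm_minus_commute)
    qed
  qed
  then show "v \<in> closure G"
    using closure_approachable[of v "closure G"] by simp
qed

text \<open>By \<open>recurrent_subset\<close> every set with the first two properties of a control
  set lies in \<open>closure G\<close>, which has both itself; maximality and uniqueness follow
  together.\<close>

lemma control_set_stable:
  assumes "\<epsilon> = 1"
  shows "control_set A \<zeta> \<Omega> (closure G)" "control_set A \<zeta> \<Omega> D \<Longrightarrow> D = closure G"
proof -
  have um: "um \<in> \<Omega>" using um_less_up by simp
  have 1: "controlled_invariant A \<zeta> \<Omega> (closure G)"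
    unfolding controlled_invariant_def
    using assms invariant_closure_G[OF um] controls_const[OF um] phi_const[OF um]
    by (metis mult_1)
  have 2: "approx_controllable A \<zeta> \<Omega> (closure G)"
    unfolding approx_controllable_def using closure_mono[OF G_subset_orbit_stable[OF assms]] by blast
  show "control_set A \<zeta> \<Omega> (closure G)"
    unfolding control_set_def using 1 2 recurrent_subset G_nonempty by blast
  show "D = closure G" if "control_set A \<zeta> \<Omega> D"
    using that 1 2 recurrent_subset[of D] unfolding control_set_def by blast
qed

text \<open>The interior of \<open>D\<close> lies in \<open>G\<close> by
  \<open>interior_closure_G\<close>. Some trajectory from \<open>v\<close> enters it, and backward
  invariance of \<open>G\<close> pulls \<open>v\<close> into \<open>G\<close>.\<close>

lemma recurrent_subset_unstable:
  assumes "\<epsilon> = -1" "controlled_invariant A \<zeta> \<Omega> D" "approx_controllable A \<zeta> \<Omega> D" "interior D \<noteq> {}"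
  shows "D \<subseteq> G"
proof
  fix v assume "v \<in> D"
  have sub: "interior D \<subseteq> G"
    using interior_mono[OF recurrent_subset[OF assms(2,3)]] interior_closure_G by simp
  obtain p where "p \<in> interior D" using assms(4) by blast
  moreover have "p \<in> closure (positive_orbit A \<zeta> \<Omega> v)"
    using assms(3) \<open>v \<in> D\<close> \<open>p \<in> interior D\<close> interior_subset unfolding approx_controllable_def by blast
  ultimately have "interior D \<inter> positive_orbit A \<zeta> \<Omega> v \<noteq> {}"
    using open_Int_closure_eq_empty[OF open_interior] by blast
  then obtain t u where tu: "0 \<le> t" "u \<in> controls \<Omega>" "\<phi> t v u \<in> G"
    using sub unfolding positive_orbit_def by blast
  have "\<phi> 0 v u \<in> G"
    using phi_G[OF tu(2) _ tu(3), of 0] tu(1) assms(1) by simp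
  then show "v \<in> G" by (simp add: phi_0 tu)
qed

text \<open>This equilibrium is the centre of symmetry, the mean of any point of \<open>G\<close>
  and its reflection. It offers a resting place inside \<open>G\<close>.\<close>

lemma midpoint_in_G: "eq ((um + up) / 2) \<in> G"
proof -
  obtain z where z: "z \<in> G" using G_nonempty by blast
  have "eq ((um + up) / 2) = eq (1 / 2 * um + 1 / 2 * up)" by (simp add: algebra_simps add_divide_distrib)
  also have "\<dots> = (1 / 2) *\<^sub>R z + (1 / 2) *\<^sub>R (eq um + (eq um + (eq up - eq um)) - z)"
    unfolding eq_lincomb by (simp add: algebra_simps)
  also have "\<dots> \<in> G" by (rule convexD[OF convex_G z G_symmetric[OF z]]) auto
  finally show ?thesis .
qed

text \<open>For controlled invariance a point is steered to the midpoint equilibrium and kept there;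
  until the arrival, backward invariance holds the trajectory in \<open>G\<close>.\<close>

lemma control_set_unstable:
  assumes "\<epsilon> = -1"
  shows "control_set A \<zeta> \<Omega> G" "control_set A \<zeta> \<Omega> D \<Longrightarrow> interior D \<noteq> {} \<Longrightarrow> D = G"
proof -
  have 1: "controlled_invariant A \<zeta> \<Omega> G"
    unfolding controlled_invariant_def
  proof
    fix v assume v: "v \<in> G"
    define c where "c = (um + up) / 2"
    have c: "c \<in> \<Omega>" using um_less_up by (simp add: c_def)
    obtain d u where u: "0 \<le> d" "u \<in> controls \<Omega>" "\<phi> d v u = eq c"
      "\<And>t. d \<le> t \<Longrightarrow> \<phi> t v u = arc c (t - d) (eq c)"
      using steer_unstable[OF assms v c] by metis
    have "\<phi> t v u \<in> G" if "0 \<le> t" for t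
    proof (cases "d \<le> t")
      case True
      then show ?thesis using u(4) midpoint_in_G by (simp add: arc_def flow_lincomb c_def)
    next
      case False
      show ?thesis
        using phi_G[OF u(2), of t d v] False u(3) midpoint_in_G assms by (simp add: c_def)
    qed
    then show "\<exists>u\<in>controls \<Omega>. \<forall>t\<ge>0. \<phi> t v u \<in> G" using u(2) by blast
  qed
  have 2: "approx_controllable A \<zeta> \<Omega> G"
    unfolding approx_controllable_def
    using G_subset_orbit_unstable[OF assms] closure_subset by blast
  have int: "interior D \<noteq> {}" if "G \<subseteq> D" for D
    using that G_nonempty interior_maximal[OF that smooth_inv_F(1)] by blast
  show "control_set A \<zeta> \<Omega> G"
    unfolding control_set_def using 1 2 recurrent_subset_unstable[OF assms] int G_nonempty by blast
  show "D = G" if "control_set A \<zeta> \<Omega> D" "interior D \<noteq> {}"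
    using that 1 2 recurrent_subset_unstable[OF assms] unfolding control_set_def by blast
qed

lemma switch_map_eq_F:
  assumes "trace_sign A = \<epsilon>"
  shows "switch_map A \<zeta> um up = F"
proof -
  have "um \<in> \<Omega>" "up \<in> \<Omega>" using um_less_up by auto
  then show ?thesis
    using assms by (auto simp: switch_map_def fun_eq_iff phi_const F_arc)
qed

end

section \<open>Matrices with real eigenvalues\<close>

text \<open>A negative discriminant gives a nonreal root \<open>lam\<close> of the characteristic
  polynomial, and \<open>b \<noteq> 0\<close> makes \<open>(b, lam - a)\<close> an eigenvector for
  it.\<close>

lemma discriminant_nonneg:
  assumes "has_real_eigenvalues A"
  shows "0 \<le> (trace A)\<^sup>2 - 4 * det A"
proof (rule ccontr)
  assume neg: "\<not> 0 \<le> (trace A)\<^sup>2 - 4 * det A"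
  define a b c d where abcd: "a = A $ 1 $ 1" "b = A $ 1 $ 2" "c = A $ 2 $ 1" "d = A $ 2 $ 2"
  have tr: "trace A = a + d" and det: "det A = a * d - b * c"
    by (simp_all add: trace_def sum_2 det_2 abcd)
  define r where "r = sqrt (4 * det A - (trace A)\<^sup>2) / 2"
  have r: "r > 0" "4 * r\<^sup>2 = 4 * det A - (trace A)\<^sup>2"
    using neg by (auto simp: r_def power_divide)
  have "b \<noteq> 0"
  proof
    assume "b = 0"
    then have "(trace A)\<^sup>2 - 4 * det A = (a - d)\<^sup>2" by (simp add: tr det power2_eq_square algebra_simps)
    then show False using neg by simp
  qed
  define lam where "lam = Complex ((a + d) / 2) r"
  have char: "lam * lam - of_real (a + d) * lam + of_real (a * d - b * c) = 0"
    using r(2) by (simp add: lam_def complex_eq_iff tr det power2_eq_square field_simps)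
  define w :: "complex^2" where "w = vector [of_real b, lam - of_real a]"
  have "w \<noteq> 0" using \<open>b \<noteq> 0\<close> by (auto simp: w_def vec_eq_iff forall_2)
  moreover have "(\<chi> i j. complex_of_real (A $ i $ j)) *v w = lam *s w"
    using char by (simp add: vec_eq_iff forall_2 matrix_vector_mult_def sum_2 w_def abcd[symmetric] algebra_simps)
  ultimately have "lam \<in> \<real>" using assms unfolding has_real_eigenvalues_def by blast
  then show False using r by (simp add: lam_def complex_is_Real_iff)
qed

lemma cayley_hamilton_2:
  fixes B :: "real^2^2"
  shows "B *v (B *v v) = trace B *\<^sub>R (B *v v) - det B *\<^sub>R v"
  by (simp add: vec_eq_iff forall_2 matrix_vector_mult_def sum_2 trace_def det_2 algebra_simps)

theorem theorem3p8:
  fixes A :: "real^2^2" and \<zeta> :: "real^2" and um up :: real and \<Omega> :: "real set"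
    and f :: "real \<times> real \<Rightarrow> real^2"
  assumes real_eig: "has_real_eigenvalues A"
    and nonzero: "\<zeta> \<noteq> 0"
    and range: "um < up" "\<Omega> = {um..up}"
    and larc: "LARC A \<zeta>"
    and det_pos: "det A > 0"
    and f_eq: "f = switch_map A \<zeta> um up"
  shows "diffeomorphism_onto_image f ({0<..} \<times> {0<..}) \<and>
    (\<exists>C. control_set A \<zeta> \<Omega> C \<and> interior C \<noteq> {} \<and>
         (\<forall>D. control_set A \<zeta> \<Omega> D \<and> interior D \<noteq> {} \<longrightarrow> D = C) \<and>
         interior C = f ` ({0<..} \<times> {0<..}) \<and>
         (trace A < 0 \<longrightarrow> closed C) \<and>
         (trace A > 0 \<longrightarrow> open C))"
proof -
  define \<epsilon> where "\<epsilon> = trace_sign A"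
  \<comment> \<open>Together with \<open>det A > 0\<close> this forces a nonzero trace.\<close>
  have disc: "0 \<le> (trace A)\<^sup>2 - 4 * det A" by (rule discriminant_nonneg[OF real_eig])
  then have tr: "trace A \<noteq> 0" using det_pos by auto
  have eps: "\<epsilon> = 1 \<or> \<epsilon> = -1" by (simp add: \<epsilon>_def trace_sign_def)
  have tr_neg: "\<epsilon> * trace A < 0" using tr by (simp add: \<epsilon>_def trace_sign_def)
  define r where "r = sqrt ((trace A)\<^sup>2 - 4 * det A)"
  have r: "0 \<le> r" "r\<^sup>2 = (trace A)\<^sup>2 - 4 * det A" using disc by (simp_all add: r_def)
  \<comment> \<open>The eigenvalues of \<open>\<epsilon> *\<^sub>R A\<close>, whose determinant is
    \<open>det A\<close> because the dimension is two. The root \<open>r\<close> stays below the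
    absolute trace, so both are negative.\<close>
  define \<mu>1 \<mu>2 where mu: "\<mu>1 = (\<epsilon> * trace A + r) / 2" "\<mu>2 = (\<epsilon> * trace A - r) / 2"
  have "r\<^sup>2 < (\<epsilon> * trace A)\<^sup>2" using r det_pos eps by auto
  then have "r < \<bar>\<epsilon> * trace A\<bar>" using r(1) abs_le_square_iff[of "\<epsilon> * trace A" r] by auto
  then have mu_neg: "\<mu>1 < 0" using tr_neg by (simp add: mu)
  have mu_sum: "\<mu>1 + \<mu>2 = \<epsilon> * trace A" by (simp add: mu field_simps)
  have mu_prod: "\<mu>1 * \<mu>2 = det A"
    using r(2) eps by (auto simp: mu power2_eq_square field_simps)
  define B where "B = \<epsilon> *\<^sub>R A"
  have B: "B *v v = \<epsilon> *\<^sub>R (A *v v)" for v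
    by (simp add: B_def scaleR_matrix_vector_assoc)
  have larc': "cross \<zeta> (A *v \<zeta>) \<noteq> 0"
    using larc by (simp add: LARC_def rot90_def cross_def inner_vec_def matrix_vector_mult_def sum_2 algebra_simps)
  interpret control_system B \<mu>1 \<mu>2 A \<epsilon> \<zeta> um up
  proof
    show "B *v (B *v v) = (\<mu>1 + \<mu>2) *\<^sub>R (B *v v) - (\<mu>1 * \<mu>2) *\<^sub>R v" for v
      unfolding mu_sum mu_prod B matrix_vector_mult_scaleR
      using eps by (auto simp: cayley_hamilton_2)
    show "A *v v = \<epsilon> *\<^sub>R (B *v v)" for v using eps by (auto simp: B)
    show "invertible A" using det_pos by (simp add: invertible_det_nz)
    show "cross \<zeta> (B *v \<zeta>) \<noteq> 0" using larc' eps by (auto simp: B cross_algebra)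
  qed (use r mu_neg eps range in \<open>auto simp: mu\<close>)
  have fF: "f = F" using switch_map_eq_F by (simp add: f_eq \<epsilon>_def)
  have im: "f ` ({0<..} \<times> {0<..}) = G" by (simp add: fF G_def)
  show ?thesis
  proof (intro conjI)
    show "diffeomorphism_onto_image f ({0<..} \<times> {0<..})" using diffeomorphism_F by (simp add: fF)
    show "\<exists>C. control_set A \<zeta> \<Omega> C \<and> interior C \<noteq> {} \<and>
         (\<forall>D. control_set A \<zeta> \<Omega> D \<and> interior D \<noteq> {} \<longrightarrow> D = C) \<and>
         interior C = f ` ({0<..} \<times> {0<..}) \<and>
         (trace A < 0 \<longrightarrow> closed C) \<and> (trace A > 0 \<longrightarrow> open C)"
    proof (cases "trace A < 0")
      case True
      then have e: "\<epsilon> = 1" by (simp add: \<epsilon>_def trace_sign_def)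
      show ?thesis unfolding im range(2)
      proof (intro exI conjI allI impI)
        show "control_set A \<zeta> {um..up} (closure G)" by (rule control_set_stable(1)[OF e])
        show "D = closure G" if "control_set A \<zeta> {um..up} D \<and> interior D \<noteq> {}" for D
          using that control_set_stable(2)[OF e] by blast
      qed (use True interior_closure_G G_nonempty in auto)
    next
      case False
      then have e: "\<epsilon> = -1" by (simp add: \<epsilon>_def trace_sign_def)
      have "open G" by (rule smooth_inv_F(1))
      then have "interior G = G" by (rule interior_open)
      show ?thesis unfolding im range(2)
      proof (intro exI conjI allI impI)
        show "control_set A \<zeta> {um..up} G" by (rule control_set_unstable(1)[OF e])
        show "D = G" if "control_set A \<zeta> {um..up} D \<and> interior D \<noteq> {}" for D
          using that control_set_unstable(2)[OF e] by blast
      qed (use False \<open>open G\<close> \<open>interior G = G\<close> G_nonempty in auto)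
    qed
  qed
qed

end
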